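(* Let $g$ be an analytic function in the unit disc $\mathbb{D}$. The following are equivalent: (i) The generalized Hilbert operator $\mathcal{H}_g$ is Hilbert–Schmidt on $H^2$. (ii) $\mathcal{H}_g$ is Hilbert–Schmidt on $A^2_\alpha$ for every $\alpha$ with $-1<\alpha<0$. (iii) $\mathcal{H}_g$ is Hilbert–Schmidt on $\mathcal{D}^2_\alpha$ for every $\alpha$ with $0<\alpha\le1$. (iv) $g$ belongs to the classical Dirichlet space $\mathcal{D}$.
   Context: $dA=\frac1\pi dx\,dy$ on $\mathbb{D}$. $H^2$ is the Hardy space of analytic $f$ in $\mathbb{D}$ with $\|f\|_{H^2}=\sup_{0<r<1}\left(\frac1{2\pi}\int_0^{2\pi}|f(re^{it})|^2\,dt\right)^{1/2}<\infty$. For $\alpha>-1$, $A^2_\alpha$ is the weighted Bergman space of analytic $f$ with $\|f\|_{A^2_\alpha}^2=(\alpha+1)\int_{\mathbb{D}}|f(z)|^2(1-|z|^2)^\alpha\,dA(z)<\infty$, and $\mathcal{D}^2_\alpha$ is the space of analytic $f$ with $\|f\|_{\mathcal{D}^2_\alpha}^2=|f(0)|^2+\|f'\|_{A^2_\alpha}^2<\infty$. The classical Dirichlet space is $\mathcal{D}=\mathcal{D}^2_0$. The generalized Hilbert operator is $\mathcal{H}_g(f)(z)=\int_0^1 f(t)g'(tz)\,dt$, $z\in\mathbb{D}$, defined for analytic $f$ with $\int_0^1|f(t)|\,dt<\infty$ (which holds for all $f$ in the spaces in (i)–(iii)). An operator $T$ on a separable Hilbert space $H$ is Hilbert–Schmidt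 if $\sum_n\|T(e_n)\|^2<\infty$ for an (equivalently every) orthonormal basis $\{e_n\}$ of $H$. *)

theory Defs
  imports "HOL-Complex_Analysis.Complex_Analysis"
begin

text \<open>
  Spaces of analytic functions on the unit disc \<open>\<D>\<close> are given by a carrier set of functions
  \<open>f :: complex \<Rightarrow> complex\<close> together with a norm. Carriers and norms depend only on the
  values of \<open>f\<close> on \<open>\<D>\<close>; two functions agreeing on \<open>\<D>\<close> are the same element of the
  space, i.e. the norm of their difference is 0. Equality of elements is therefore always
  expressed through the norm.
\<close>

abbreviation unit_disc :: "complex set" where
  "unit_disc \<equiv> ball 0 1"


definition circle_mean :: "real \<Rightarrow> (complex \<Rightarrow> complex) \<Rightarrow> real" where
  "circle_mean r f =
     sqrt (1 / (2 * pi) * integral {0..2 * pi} (\<lambda>t. (cmod (f (of_real r * cis t)))\<^sup>2))"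

definition hardy_norm :: "(complex \<Rightarrow> complex) \<Rightarrow> real" where
  "hardy_norm f = (SUP r\<in>{0<..<1}. circle_mean r f)"

definition hardy_space :: "(complex \<Rightarrow> complex) set" where
  "hardy_space =
     {f. f holomorphic_on unit_disc \<and> bdd_above ((\<lambda>r. circle_mean r f) ` {0<..<1})}"


text \<open>The factor \<open>1 / pi\<close> normalises the area measure on the disc.\<close>

definition bergman_norm :: "real \<Rightarrow> (complex \<Rightarrow> complex) \<Rightarrow> real" where
  "bergman_norm \<alpha> f =
     sqrt ((\<alpha> + 1) * (1 / pi) *
       (LINT z:unit_disc|lborel. (cmod (f z))\<^sup>2 * (1 - (cmod z)\<^sup>2) powr \<alpha>))"

definition bergman_space :: "real \<Rightarrow> (complex \<Rightarrow> complex) set" where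
  "bergman_space \<alpha> =
     {f. f holomorphic_on unit_disc \<and>
         set_integrable lborel unit_disc (\<lambda>z. (cmod (f z))\<^sup>2 * (1 - (cmod z)\<^sup>2) powr \<alpha>)}"


definition dirichlet_norm :: "real \<Rightarrow> (complex \<Rightarrow> complex) \<Rightarrow> real" where
  "dirichlet_norm \<alpha> f = sqrt ((cmod (f 0))\<^sup>2 + (bergman_norm \<alpha> (deriv f))\<^sup>2)"

definition dirichlet_space :: "real \<Rightarrow> (complex \<Rightarrow> complex) set" where
  "dirichlet_space \<alpha> = {f. f holomorphic_on unit_disc \<and> deriv f \<in> bergman_space \<alpha>}"


text \<open>The integral is over \<open>{0..<1}\<close> since \<open>f\<close> is only meaningful on the open disc.\<close>

definition generalized_hilbert ::
    "(complex \<Rightarrow> complex) \<Rightarrow> (complex \<Rightarrow> complex) \<Rightarrow> complex \<Rightarrow> complex" where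
  "generalized_hilbert g f z =
     (LINT t:{0..<1::real}|lborel. f (of_real t) * deriv g (of_real t * z))"


text \<open>
  The inner product inducing a Hilbert space norm \<open>N\<close>, recovered by the polarization identity
  (linear in the first argument).
\<close>

definition inner_of_norm ::
    "(('a \<Rightarrow> complex) \<Rightarrow> real) \<Rightarrow> ('a \<Rightarrow> complex) \<Rightarrow> ('a \<Rightarrow> complex) \<Rightarrow> complex" where
  "inner_of_norm N f h =
     (1 / 4) * (\<Sum>k<4. \<i> ^ k * of_real ((N (\<lambda>z. f z + \<i> ^ k * h z))\<^sup>2))"

definition orthonormal_basis ::
    "('a \<Rightarrow> complex) set \<Rightarrow> (('a \<Rightarrow> complex) \<Rightarrow> real) \<Rightarrow> (nat \<Rightarrow> 'a \<Rightarrow> complex) \<Rightarrow> bool" where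
  "orthonormal_basis H N e \<longleftrightarrow>
     (\<forall>n. e n \<in> H) \<and>
     (\<forall>m n. inner_of_norm N (e m) (e n) = (if m = n then 1 else 0)) \<and>
     (\<forall>f\<in>H. (\<lambda>n. N (\<lambda>z. f z - (\<Sum>k<n. inner_of_norm N f (e k) * e k z))) \<longlonglongrightarrow> 0)"

definition bounded_operator_on ::
    "('a \<Rightarrow> complex) set \<Rightarrow> (('a \<Rightarrow> complex) \<Rightarrow> real) \<Rightarrow>
     (('a \<Rightarrow> complex) \<Rightarrow> 'a \<Rightarrow> complex) \<Rightarrow> bool" where
  "bounded_operator_on H N T \<longleftrightarrow>
     (\<forall>f\<in>H. T f \<in> H) \<and>
     (\<forall>f\<in>H. \<forall>h\<in>H. \<forall>a b. N (\<lambda>z. T (\<lambda>w. a * f w + b * h w) z - (a * T f z + b * T h z)) = 0) \<and>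
     (\<exists>C. \<forall>f\<in>H. N (T f) \<le> C * N f)"

definition hilbert_schmidt_on ::
    "('a \<Rightarrow> complex) set \<Rightarrow> (('a \<Rightarrow> complex) \<Rightarrow> real) \<Rightarrow>
     (('a \<Rightarrow> complex) \<Rightarrow> 'a \<Rightarrow> complex) \<Rightarrow> bool" where
  "hilbert_schmidt_on H N T \<longleftrightarrow>
     bounded_operator_on H N T \<and>
     (\<exists>e. orthonormal_basis H N e \<and> summable (\<lambda>n. (N (T (e n)))\<^sup>2))"

end

theory Submission
  imports Defs "HOL-Real_Asymp.Real_Asymp"
begin

text \<open>
  In terms of Taylor coefficients each of the spaces is a weighted \<open>\<ell>\<^sup>2\<close> space whose weights
  \<open>w n\<close> are comparable to \<open>(n + 1) powr s\<close> for some \<open>-1 < s < 1\<close>: \<open>s = 0\<close> for the Hardy space,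
  \<open>s = -1 - \<alpha>\<close> for the Bergman and \<open>s = 1 - \<alpha>\<close> for the Dirichlet spaces.
  The \<open>m\<close>-th coefficient of \<open>\<H>\<^sub>g f\<close> is the \<open>m\<close>-th coefficient of \<open>g'\<close> times the moment
  \<open>\<integral>\<^sub>0\<^sup>1 f(t) t\<^sup>m dt\<close>, a bounded functional of \<open>f\<close> whose squared norm is
  \<open>S m = (\<Sum>k. 1 / (w k * (m + k + 1)\<^sup>2))\<close>, which is comparable to \<open>(m + 1) powr (-1 - s)\<close>.
  By Parseval's identity, applied to the representing functions of these moments, the Hilbert--Schmidt sum
  over any orthonormal basis equals \<open>\<Sum>m. w m * |m-th coefficient of g'|\<^sup>2 * S m\<close>.
  The factor \<open>w m * S m\<close> is comparable to \<open>1 / (m + 1)\<close> whatever \<open>s\<close> is, so the sum is finite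
  exactly when \<open>g\<close> lies in the classical Dirichlet space.
\<close>

subsection \<open>Taylor coefficients and the Hardy space\<close>

text \<open>Both ends of the range -1 < s < 1 are used in the estimate of \<open>S m\<close>. The
  terms with k <= m add up to the order (m + 1) powr (-1 - s) because s < 1, the later ones because
  -1 < s. The endpoint \<alpha> = 0 falls outside: for the Bergman spaces it gives s = -1, where the
  series \<open>S m\<close> diverges and the moments are no longer bounded functionals; for the
  Dirichlet spaces it gives s = 1, where \<open>S m\<close> gains a logarithm. The Bergman norm is
  an area integral. Polar coordinates are replaced by averaging over rotations, which rests on the
  rotation invariance of Lebesgue measure and turns the inner integral into Parseval's identity on a
  circle. The Hilbert--Schmidt condition asks for some orthonormal basis. One implication therefore
  has to work with an arbitrary basis, about which only the convergence of its expansions is known,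
  while the other exhibits the normalised monomials. All double sums have nonnegative terms, so
  cutting off one index and summing over the other replaces their interchange.\<close>

abbreviation coef :: "(complex \<Rightarrow> complex) \<Rightarrow> nat \<Rightarrow> complex" where
  "coef f n \<equiv> fps_nth (fps_expansion f 0) n"

lemma coef_sums:
  assumes "f holomorphic_on unit_disc" "cmod z < 1"
  shows "(\<lambda>n. coef f n * z ^ n) sums f z"
  using holomorphic_power_series[OF assms(1), of z] assms(2) by (simp add: fps_expansion_def)

text \<open>Uniqueness of power series in the form used below:
  \<open>generalized_hilbert g f\<close>, \<open>representer m\<close> and \<open>monomial k\<close>
  are known through pointwise expansions, from which holomorphy and coefficients are read off
  together.\<close>

lemma coef_eqI:
  assumes "\<And>z. cmod z < 1 \<Longrightarrow> (\<lambda>n. c n * z ^ n) sums f z"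
  shows "f holomorphic_on unit_disc" "coef f n = c n"
proof -
  show "f holomorphic_on unit_disc"
    using power_series_holomorphic[of 0 1 c f] assms by simp
  have "f has_fps_expansion Abs_fps c"
    unfolding has_fps_expansion_def
  proof
    \<comment> \<open>Convergence at a single nonzero point already gives a positive radius of
      convergence.\<close>
    have "summable (\<lambda>n. c n * (1 / 2) ^ n)"
      using assms[of "1/2"] by (simp add: sums_iff)
    from conv_radius_geI[OF this] have "fps_conv_radius (Abs_fps c) \<ge> ereal (1/2)"
      by (simp add: fps_conv_radius_def)
    then show "fps_conv_radius (Abs_fps c) > 0"
      by (rule less_le_trans[rotated]) simp
    show "\<forall>\<^sub>F z in nhds 0. eval_fps (Abs_fps c) z = f z"
      using eventually_nhds_in_open[of unit_disc "0::complex"]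
      by (auto elim!: eventually_mono simp: eval_fps_def dest!: assms intro!: sums_unique[symmetric])
  qed
  from fps_expansion_eqI[OF this] show "coef f n = c n" by simp
qed

lemma coef_norm_summable:
  assumes "f holomorphic_on unit_disc" "0 \<le> r" "r < 1"
  shows "summable (\<lambda>n. cmod (coef f n) * r ^ n)"
proof -
  \<comment> \<open>Convergence at \<open>x\<close> forces absolute convergence at the smaller
    radius \<open>r\<close>.\<close>
  obtain x where x: "r < x" "x < 1" using dense[OF assms(3)] by auto
  have "summable (\<lambda>n. coef f n * complex_of_real x ^ n)"
    using coef_sums[OF assms(1), of "of_real x"] x assms(2) by (simp add: sums_iff)
  from powser_insidea[OF this, of "of_real r"] x assms(2)
  show ?thesis by (simp add: norm_mult norm_power)
qed

lemma coef_lincomb: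
  assumes "f holomorphic_on unit_disc" "h holomorphic_on unit_disc"
  shows "coef (\<lambda>z. a * f z + b * h z) n = a * coef f n + b * coef h n"
proof (rule coef_eqI(2))
  fix z :: complex assume z: "cmod z < 1"
  show "(\<lambda>n. (a * coef f n + b * coef h n) * z ^ n) sums (a * f z + b * h z)"
    using sums_add[OF sums_mult[OF coef_sums[OF assms(1) z], of a] sums_mult[OF coef_sums[OF assms(2) z], of b]]
    by (simp add: algebra_simps)
qed

lemma coef_deriv: "coef (deriv f) n = of_nat (Suc n) * coef f (Suc n)"
proof -
  have "coef (deriv f) n = (deriv ^^ Suc n) f 0 / fact n"
    by (simp add: fps_expansion_def funpow_swap1)
  also have "\<dots> = of_nat (Suc n) * coef f (Suc n)"
    by (simp add: fps_expansion_def fact_Suc del: funpow.simps of_nat_Suc)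
  finally show ?thesis .
qed

section \<open>Parseval's identity on circles\<close>

lemma integral_cis_multiple:
  "(LINT t|restrict_space lborel {0..2 * pi}. cis (of_int k * t)) = (if k = 0 then of_real (2 * pi) else 0)"
proof (cases "k = 0")
  case True
  then show ?thesis by (simp add: measure_restrict_space scaleR_conv_of_real)
next
  case False
  have int: "set_integrable lborel {0..2*pi} (\<lambda>t. cis (of_int k * t))"
    unfolding set_integrable_def
    by (rule borel_integrable_compact) (auto intro!: continuous_intros)
  have "((\<lambda>t. cis (of_int k * t)) has_integral
          cis (of_int k * (2 * pi)) / (\<i> * of_int k) - cis (of_int k * 0) / (\<i> * of_int k)) {0..2*pi}"
  proof (rule fundamental_theorem_of_calculus)
    fix t :: real
    have "((\<lambda>w. exp (\<i> * of_int k * w) / (\<i> * of_int k)) has_field_derivative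
        exp (\<i> * of_int k * of_real t)) (at (of_real t))"
      using False by (auto intro!: derivative_eq_intros)
    from has_vector_derivative_real_field[OF this] show "((\<lambda>t. cis (of_int k * t) / (\<i> * of_int k)) has_vector_derivative
        cis (of_int k * t)) (at t within {0..2*pi})"
      by (simp add: cis_conv_exp mult.assoc)
  qed simp
  moreover have "cis (of_int k * (2 * pi)) = 1"
    using cis_multiple_2pi[of "of_int k"] by (simp add: mult_ac)
  ultimately have "integral {0..2*pi} (\<lambda>t. cis (of_int k * t)) = 0"
    by (simp add: integral_unique)
  with set_borel_integral_eq_integral(2)[OF int] False show ?thesis
    by (simp add: integral_restrict_space set_lebesgue_integral_def)
qed

text \<open>Absolute summability of \<open>c\<close> dominates every series involved, so sum and
  integral may be exchanged twice: once to recover \<open>c n\<close> as a Fourier coefficient of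
  \<open>g\<close>, once to expand one factor of \<open>g t * cnj (g t)\<close>.\<close>

lemma fourier_parseval:
  fixes c :: "nat \<Rightarrow> complex"
  assumes c: "summable (\<lambda>n. cmod (c n))"
    and g: "\<And>t. (\<lambda>n. c n * cis (real n * t)) sums g t"
  defines "M \<equiv> restrict_space lborel {0..2 * pi}"
  shows "integrable M (\<lambda>t. (cmod (g t))\<^sup>2)"
    and "(\<lambda>n. (cmod (c n))\<^sup>2) sums (1 / (2 * pi) * (LINT t|M. (cmod (g t))\<^sup>2))"
proof -
  interpret finite_measure M
    unfolding M_def
    by (rule finite_measureI) (simp add: emeasure_restrict_space space_restrict_space)
  have [measurable]: "(\<lambda>t. cis (a * t)) \<in> borel_measurable M" for a
  proof -
    have "(\<lambda>t. cis (a * t)) \<in> borel_measurable borel"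
      by (intro borel_measurable_continuous_onI continuous_intros)
    then show ?thesis unfolding M_def by (intro measurable_restrict_space1) simp
  qed
  have [measurable]: "cnj \<in> borel_measurable borel"
    by (intro borel_measurable_continuous_onI continuous_intros)
  have g_eq: "g = (\<lambda>t. \<Sum>n. c n * cis (real n * t))"
    using g by (auto simp: sums_iff)
  have [measurable]: "g \<in> borel_measurable M"
    unfolding g_eq by measurable
  define B where "B = (\<Sum>n. cmod (c n))"
  have B: "cmod (g t) \<le> B" for t
  proof -
    have "cmod (g t) \<le> (\<Sum>n. cmod (c n * cis (real n * t)))"
      unfolding g_eq by (rule summable_norm) (use c in \<open>simp add: norm_mult\<close>)
    then show ?thesis by (simp add: B_def norm_mult)
  qed
  have B0: "0 \<le> B" using B[of 0] norm_ge_zero order_trans by blast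
  have int: "integrable M h" if "h \<in> borel_measurable M" "\<And>t. norm (h t) \<le> K" for h :: "real \<Rightarrow> complex" and K
    by (rule integrable_const_bound[where B=K]) (use that in auto)
  show intg: "integrable M (\<lambda>t. (cmod (g t))\<^sup>2)"
    by (rule integrable_const_bound[where B="B\<^sup>2"]) (auto intro!: power_mono B)
  have inner: "(LINT t|M. cis (real n * t) * cnj (g t)) = 2 * pi * cnj (c n)" for n
  proof -
    have "(\<lambda>m. LINT t|M. cis (real n * t) * cnj (c m * cis (real m * t))) sums
          (LINT t|M. (\<Sum>m. cis (real n * t) * cnj (c m * cis (real m * t))))"
    proof (rule sums_integral)
      show "integrable M (\<lambda>t. cis (real n * t) * cnj (c m * cis (real m * t)))" for m
        by (rule int[where K="cmod (c m)"]) (auto simp: norm_mult)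
      show "AE t in M. summable (\<lambda>m. norm (cis (real n * t) * cnj (c m * cis (real m * t))))"
        using c by (auto simp: norm_mult)
      show "summable (\<lambda>m. LINT t|M. norm (cis (real n * t) * cnj (c m * cis (real m * t))))"
        using c by (auto simp: norm_mult intro!: summable_mult)
    qed
    also have "(\<lambda>t. \<Sum>m. cis (real n * t) * cnj (c m * cis (real m * t))) = (\<lambda>t. cis (real n * t) * cnj (g t))"
    proof
      fix t
      show "(\<Sum>m. cis (real n * t) * cnj (c m * cis (real m * t))) = cis (real n * t) * cnj (g t)"
        by (rule sums_unique[symmetric], rule sums_mult, subst sums_cnj, rule g)
    qed
    also have "(\<lambda>m. LINT t|M. cis (real n * t) * cnj (c m * cis (real m * t)))
        = (\<lambda>m. if m = n then 2 * pi * cnj (c n) else 0)"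
    proof
      fix m
      have "(\<lambda>t. cis (real n * t) * cnj (c m * cis (real m * t)))
          = (\<lambda>t. cnj (c m) * cis (of_int (int n - int m) * t))"
        by (auto simp: cis_cnj cis_mult algebra_simps simp flip: cis_divide)
      then show "(LINT t|M. cis (real n * t) * cnj (c m * cis (real m * t)))
          = (if m = n then 2 * pi * cnj (c n) else 0)"
        using integral_cis_multiple[of "int n - int m"] unfolding M_def by auto
    qed
    finally show ?thesis
      using sums_unique2[OF _ sums_If_finite[of "\<lambda>m. m = n" "\<lambda>_. 2 * pi * cnj (c n)"]] by simp
  qed
  \<comment> \<open>Only the first factor of \<open>g t * cnj (g t)\<close> is expanded;
    \<open>inner\<close> evaluates each resulting term, so no double series arises.\<close>
  have "(\<lambda>n. LINT t|M. c n * (cis (real n * t) * cnj (g t))) sums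
        (LINT t|M. (\<Sum>n. c n * (cis (real n * t) * cnj (g t))))"
  proof (rule sums_integral)
    show "integrable M (\<lambda>t. c n * (cis (real n * t) * cnj (g t)))" for n
      by (rule int[where K="cmod (c n) * B"]) (auto simp: norm_mult B intro!: mult_left_mono)
    show "AE t in M. summable (\<lambda>n. norm (c n * (cis (real n * t) * cnj (g t))))"
      using c by (auto simp: norm_mult intro!: summable_mult2)
    show "summable (\<lambda>n. LINT t|M. norm (c n * (cis (real n * t) * cnj (g t))))"
      using c by (auto simp: norm_mult intro!: summable_mult2)
  qed
  also have "(\<lambda>t. \<Sum>n. c n * (cis (real n * t) * cnj (g t))) = (\<lambda>t. of_real ((cmod (g t))\<^sup>2))"
  proof
    fix t
    have "(\<lambda>n. c n * cis (real n * t) * cnj (g t)) sums (g t * cnj (g t))"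
      by (intro sums_mult2 g)
    then show "(\<Sum>n. c n * (cis (real n * t) * cnj (g t))) = of_real ((cmod (g t))\<^sup>2)"
      by (simp add: sums_iff mult.assoc complex_norm_square del: of_real_power)
  qed
  also have "(\<lambda>n. LINT t|M. c n * (cis (real n * t) * cnj (g t))) = (\<lambda>n. of_real (2 * pi * (cmod (c n))\<^sup>2))"
    unfolding integral_mult_right_zero inner
    by (simp add: complex_norm_square mult_ac del: of_real_power)
  finally have "(\<lambda>n. 2 * pi * (cmod (c n))\<^sup>2) sums (LINT t|M. (cmod (g t))\<^sup>2)"
    unfolding integral_complex_of_real sums_of_real_iff .
  from sums_mult[OF this, of "1 / (2 * pi)"]
  show "(\<lambda>n. (cmod (c n))\<^sup>2) sums (1 / (2 * pi) * (LINT t|M. (cmod (g t))\<^sup>2))" by simp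
qed

text \<open>Stated for a complex point \<open>z\<close> rather than a radius, because the disc
  integral is later averaged over the rotation orbit of each \<open>z\<close>; the Hardy means use
  real \<open>z\<close>.\<close>

lemma circle_parseval:
  assumes f: "f holomorphic_on unit_disc" and z: "cmod z < 1"
  defines "M \<equiv> restrict_space lborel {0..2 * pi}"
  shows "integrable M (\<lambda>t. (cmod (f (z * cis t)))\<^sup>2)"
    and "(\<lambda>n. (cmod (coef f n))\<^sup>2 * (cmod z) ^ (2 * n)) sums
           (1 / (2 * pi) * (LINT t|M. (cmod (f (z * cis t)))\<^sup>2))"
proof -
  have 1: "summable (\<lambda>n. cmod (coef f n * z ^ n))"
    using coef_norm_summable[OF f _ z] by (simp add: norm_mult norm_power)
  have 2: "(\<lambda>n. coef f n * z ^ n * cis (real n * t)) sums f (z * cis t)" for t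
    using coef_sums[OF f, of "z * cis t"] z
    by (simp add: norm_mult power_mult_distrib Complex.DeMoivre mult.assoc)
  show "integrable M (\<lambda>t. (cmod (f (z * cis t)))\<^sup>2)"
    using fourier_parseval(1)[OF 1 2] by (simp add: M_def)
  show "(\<lambda>n. (cmod (coef f n))\<^sup>2 * (cmod z) ^ (2 * n)) sums
           (1 / (2 * pi) * (LINT t|M. (cmod (f (z * cis t)))\<^sup>2))"
    using fourier_parseval(2)[OF 1 2]
    by (simp add: M_def norm_mult norm_power power_mult_distrib power_mult mult_ac flip: power_mult)
qed

section \<open>Hardy space in terms of coefficients\<close>

lemma circle_mean_sums:
  assumes f: "f holomorphic_on unit_disc" and r: "0 < r" "r < 1"
  shows "(\<lambda>n. (cmod (coef f n))\<^sup>2 * r ^ (2 * n)) sums (circle_mean r f)\<^sup>2" "0 \<le> circle_mean r f"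
proof -
  have z: "cmod (of_real r) < 1" using r by simp
  \<comment> \<open>\<open>circle_mean\<close> uses the gauge integral, Parseval's identity the
    Lebesgue integral.\<close>
  have eq: "(LINT t|restrict_space lborel {0..2 * pi}. (cmod (f (of_real r * cis t)))\<^sup>2) =
     integral {0..2 * pi} (\<lambda>t. (cmod (f (of_real r * cis t)))\<^sup>2)"
    using circle_parseval(1)[OF f z] set_borel_integral_eq_integral(2)[of "{0..2 * pi}" "\<lambda>t. (cmod (f (of_real r * cis t)))\<^sup>2"]
    by (simp add: integral_restrict_space integrable_restrict_space set_lebesgue_integral_def set_integrable_def)
  have nn: "0 \<le> 1 / (2 * pi) * integral {0..2 * pi} (\<lambda>t. (cmod (f (of_real r * cis t)))\<^sup>2)"
    unfolding eq[symmetric] by (intro mult_nonneg_nonneg integral_nonneg) auto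
  show "(\<lambda>n. (cmod (coef f n))\<^sup>2 * r ^ (2 * n)) sums (circle_mean r f)\<^sup>2"
    using circle_parseval(2)[OF f z] r nn unfolding eq circle_mean_def by (simp add: norm_power del: power_mult)
  show "0 \<le> circle_mean r f" using nn unfolding circle_mean_def by simp
qed

text \<open>Each partial sum is a polynomial in \<open>r\<close> bounded by the squared circle mean;
  letting \<open>r\<close> tend to 1 from the left removes the powers of \<open>r\<close>.\<close>

lemma circle_mean_bound_imp:
  assumes f: "f holomorphic_on unit_disc" and B: "\<And>r. 0 < r \<Longrightarrow> r < 1 \<Longrightarrow> circle_mean r f \<le> B"
  shows "summable (\<lambda>n. (cmod (coef f n))\<^sup>2)" "(\<Sum>n. (cmod (coef f n))\<^sup>2) \<le> B\<^sup>2"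
proof -
  have part: "(\<Sum>n<N. (cmod (coef f n))\<^sup>2) \<le> B\<^sup>2" for N
  proof -
    have "((\<lambda>r. \<Sum>n<N. (cmod (coef f n))\<^sup>2 * r ^ (2 * n)) \<longlongrightarrow> (\<Sum>n<N. (cmod (coef f n))\<^sup>2 * 1 ^ (2 * n))) (at_left 1)"
      by (intro tendsto_intros)
    moreover have "\<forall>\<^sub>F r in at_left (1::real). (\<Sum>n<N. (cmod (coef f n))\<^sup>2 * r ^ (2 * n)) \<le> B\<^sup>2"
      using eventually_at_left_real[of 0 1]
    proof (rule eventually_mono)
      show "(0::real) < 1" by simp
      fix r :: real assume r: "r \<in> {0<..<1}"
      then have r': "0 < r" "r < 1" by auto
      note s = circle_mean_sums[OF f r']
      have "(\<Sum>n<N. (cmod (coef f n))\<^sup>2 * r ^ (2 * n)) \<le> (\<Sum>n. (cmod (coef f n))\<^sup>2 * r ^ (2 * n))"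
        using s(1) r' by (intro sum_le_suminf) (auto simp: sums_iff)
      also have "\<dots> = (circle_mean r f)\<^sup>2" using s(1) by (simp add: sums_iff)
      also have "\<dots> \<le> B\<^sup>2" by (intro power_mono B r' s(2))
      finally show "(\<Sum>n<N. (cmod (coef f n))\<^sup>2 * r ^ (2 * n)) \<le> B\<^sup>2" .
    qed
    ultimately show ?thesis
      using tendsto_upperbound[where F="at_left (1::real)"] by fastforce
  qed
  show "summable (\<lambda>n. (cmod (coef f n))\<^sup>2)"
    by (rule bounded_imp_summable[where B="B\<^sup>2"]) (use part[of "Suc _"] in \<open>auto simp: lessThan_Suc_atMost\<close>)
  then show "(\<Sum>n. (cmod (coef f n))\<^sup>2) \<le> B\<^sup>2"
    by (rule suminf_le_const) (rule part)
qed

lemma circle_mean_le: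
  assumes f: "f holomorphic_on unit_disc" and "summable (\<lambda>n. (cmod (coef f n))\<^sup>2)" and r: "0 < r" "r < 1"
  shows "circle_mean r f \<le> sqrt (\<Sum>n. (cmod (coef f n))\<^sup>2)"
proof (rule real_le_rsqrt)
  note s = circle_mean_sums[OF f r]
  have "(circle_mean r f)\<^sup>2 = (\<Sum>n. (cmod (coef f n))\<^sup>2 * r ^ (2 * n))" using s(1) by (simp add: sums_iff)
  also have "\<dots> \<le> (\<Sum>n. (cmod (coef f n))\<^sup>2)"
    using s(1) r assms(2) by (intro suminf_le) (auto simp: sums_iff intro!: mult_left_le power_le_one)
  finally show "(circle_mean r f)\<^sup>2 \<le> (\<Sum>n. (cmod (coef f n))\<^sup>2)" .
qed

lemma hardy_space_iff:
  "f \<in> hardy_space \<longleftrightarrow> f holomorphic_on unit_disc \<and> summable (\<lambda>n. (cmod (coef f n))\<^sup>2)"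
proof safe
  assume "f \<in> hardy_space"
  then show f: "f holomorphic_on unit_disc" by (simp add: hardy_space_def)
  from \<open>f \<in> hardy_space\<close> obtain B where "\<And>r. 0 < r \<Longrightarrow> r < 1 \<Longrightarrow> circle_mean r f \<le> B"
    by (fastforce simp: hardy_space_def bdd_above_def)
  from circle_mean_bound_imp(1)[OF f this] show "summable (\<lambda>n. (cmod (coef f n))\<^sup>2)" .
next
  assume f: "f holomorphic_on unit_disc" and "summable (\<lambda>n. (cmod (coef f n))\<^sup>2)"
  from circle_mean_le[OF this] show "f \<in> hardy_space"
    by (auto simp: hardy_space_def f intro!: bdd_aboveI2)
qed

lemma hardy_norm_eq:
  assumes "f \<in> hardy_space"
  shows "hardy_norm f = sqrt (\<Sum>n. (cmod (coef f n))\<^sup>2)"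
proof (rule antisym)
  from assms have f: "f holomorphic_on unit_disc" and s: "summable (\<lambda>n. (cmod (coef f n))\<^sup>2)"
    unfolding hardy_space_iff by auto
  from assms have bdd: "bdd_above ((\<lambda>r. circle_mean r f) ` {0<..<1})"
    by (simp add: hardy_space_def)
  show "hardy_norm f \<le> sqrt (\<Sum>n. (cmod (coef f n))\<^sup>2)"
    unfolding hardy_norm_def by (rule cSUP_least) (auto intro!: circle_mean_le f s)
  have le: "circle_mean r f \<le> hardy_norm f" if "0 < r" "r < 1" for r
    unfolding hardy_norm_def by (rule cSUP_upper2[OF bdd]) (use that in auto)
  have "0 \<le> hardy_norm f"
    using circle_mean_sums(2)[OF f, of "1/2"] le[of "1/2"] by simp
  with circle_mean_bound_imp(2)[OF f le] show "sqrt (\<Sum>n. (cmod (coef f n))\<^sup>2) \<le> hardy_norm f"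
    by (intro real_le_lsqrt)
qed

subsection \<open>Rotation invariance and the Bergman spaces\<close>

text \<open>
  With \<open>B\<close> the unit ball, both sides of \<open>M A * lborel B = lborel A * M B\<close> are the double integral
  of \<open>indicator B y * indicator A (y + x)\<close>: integrate over \<open>x\<close> first, or swap and translate \<open>y\<close> first.
\<close>

lemma translation_invariant_eq_lborel:
  fixes M :: "'a::euclidean_space measure"
  assumes sets[measurable_cong]: "sets M = sets borel" and sf: "sigma_finite_measure M"
    and inv: "\<And>a. distr M borel ((+) a) = M"
    and ball: "emeasure M (ball 0 1) = emeasure lborel (ball (0::'a) 1)"
  shows "M = lborel"
proof (rule measure_eqI)
  fix A assume "A \<in> sets M"
  then have A[measurable]: "A \<in> sets borel" using sets by simp
  interpret M: sigma_finite_measure M by fact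
  interpret pair_sigma_finite M "lborel :: 'a measure" ..
  let ?B = "ball (0::'a) 1"
  have [measurable]: "?B \<in> sets borel" by simp
  have [measurable]: "(\<lambda>p. indicator A (snd p + fst p) :: ennreal) \<in> borel_measurable (M \<Otimes>\<^sub>M lborel)"
    by (rule measurable_compose[OF _ borel_measurable_indicator[OF A]]) measurable
  have transl: "(\<integral>\<^sup>+x. f (a + x) \<partial>M) = (\<integral>\<^sup>+x. f x \<partial>M)" if [measurable]: "f \<in> borel_measurable borel" for f :: "'a \<Rightarrow> ennreal" and a
    by (subst (2) inv[of a, symmetric], subst nn_integral_distr) auto
  have translL: "(\<integral>\<^sup>+x. f (a + x) \<partial>lborel) = (\<integral>\<^sup>+x. f x \<partial>lborel)" if [measurable]: "f \<in> borel_measurable borel" for f :: "'a \<Rightarrow> ennreal" and a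
    by (subst (2) lborel_distr_plus[of a, symmetric], subst nn_integral_distr) auto
  have "(\<integral>\<^sup>+x. indicator A (y + x) \<partial>M) = emeasure M A" for y
    by (simp add: transl sets)
  then have "emeasure M A * emeasure lborel ?B = (\<integral>\<^sup>+y. indicator ?B y * (\<integral>\<^sup>+x. indicator A (y + x) \<partial>M) \<partial>lborel)"
    by (simp add: nn_integral_cmult_indicator mult.commute[of "indicator ?B _"])
  also have "\<dots> = (\<integral>\<^sup>+y. \<integral>\<^sup>+x. indicator ?B y * indicator A (y + x) \<partial>M \<partial>lborel)"
    by (intro nn_integral_cong nn_integral_cmult[symmetric]) measurable
  also have "\<dots> = (\<integral>\<^sup>+x. \<integral>\<^sup>+y. indicator ?B y * indicator A (y + x) \<partial>lborel \<partial>M)"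
    by (rule Fubini') measurable
  also have "\<dots> = (\<integral>\<^sup>+x. \<integral>\<^sup>+y. indicator ?B (y - x) * indicator A y \<partial>lborel \<partial>M)"
  proof (rule nn_integral_cong)
    fix x
    show "(\<integral>\<^sup>+y. indicator ?B y * indicator A (y + x) \<partial>lborel) = (\<integral>\<^sup>+y. indicator ?B (y - x) * indicator A y \<partial>lborel)"
      using translL[of "\<lambda>y. indicator ?B (y - x) * indicator A y" x] by (simp add: add.commute)
  qed
  also have "\<dots> = (\<integral>\<^sup>+y. \<integral>\<^sup>+x. indicator ?B (y - x) * indicator A y \<partial>M \<partial>lborel)"
    by (rule Fubini'[symmetric]) measurable
  also have "\<dots> = (\<integral>\<^sup>+y. (\<integral>\<^sup>+x. indicator ?B x \<partial>M) * indicator A y \<partial>lborel)"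
  proof (intro nn_integral_cong)
    fix y
    have "(\<integral>\<^sup>+x. indicator ?B x \<partial>M) = (\<integral>\<^sup>+x. indicator ?B (- y + x) \<partial>M)"
      by (rule transl[symmetric]) measurable
    also have "\<dots> = (\<integral>\<^sup>+x. indicator ?B (y - x) \<partial>M)"
      by (intro nn_integral_cong) (auto simp: indicator_def norm_minus_commute)
    finally show "(\<integral>\<^sup>+x. indicator ?B (y - x) * indicator A y \<partial>M) = (\<integral>\<^sup>+x. indicator ?B x \<partial>M) * indicator A y"
      by (simp add: nn_integral_multc)
  qed
  also have "\<dots> = (\<integral>\<^sup>+x. indicator ?B x \<partial>M) * emeasure lborel A"
    by (rule nn_integral_cmult_indicator) simp
  also have "\<dots> = emeasure lborel A * emeasure lborel ?B"
    using ball by (simp add: sets mult.commute)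
  finally have "emeasure M A * emeasure lborel ?B = emeasure lborel A * emeasure lborel ?B" .
  moreover have "emeasure lborel ?B \<noteq> 0" "emeasure lborel ?B \<noteq> \<infinity>"
    using unit_ball_vol_pos[of "real DIM('a)"]
    by (simp_all add: emeasure_ball del: unit_ball_vol_pos)
  ultimately show "emeasure M A = emeasure lborel A"
    by (metis ennreal_mult_divide_eq infinity_ennreal_def)
qed (simp add: sets)

text \<open>Multiplication by \<open>c\<close> carries translation by \<open>a / c\<close> to
  translation by \<open>a\<close>, so the image measure is again translation invariant; it gives the
  unit ball its usual volume because |c| = 1.\<close>

lemma distr_lborel_mult_unit:
  assumes c: "cmod c = 1"
  shows "distr lborel borel ((*) c) = lborel"
proof (rule translation_invariant_eq_lborel)
  have [simp]: "c \<noteq> 0" using c by auto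
  \<comment> \<open>Multiplying back by \<open>inverse c\<close> returns \<open>lborel\<close>;
    sigma-finiteness of an image measure passes to the original one.\<close>
  have "distr (distr lborel borel ((*) c)) borel ((*) (inverse c)) = distr lborel borel (\<lambda>x. x)"
    by (subst distr_distr) (auto simp: o_def field_simps)
  then have "sigma_finite_measure (distr (distr lborel borel ((*) c)) borel ((*) (inverse c)))"
    using lborel.sigma_finite_measure_axioms by (simp add: distr_id2)
  then show "sigma_finite_measure (distr lborel borel ((*) c))"
    by (rule sigma_finite_measure_distr) simp
  fix a
  have "distr (distr lborel borel ((*) c)) borel ((+) a) = distr (distr lborel borel ((+) (a / c))) borel ((*) c)"
    by (auto simp: distr_distr o_def algebra_simps)
  then show "distr (distr lborel borel ((*) c)) borel ((+) a) = distr lborel borel ((*) c)"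
    by (simp add: lborel_distr_plus)
next
  have "(*) c -` ball 0 1 = ball 0 1" using c by (auto simp: norm_mult)
  then show "emeasure (distr lborel borel ((*) c)) (ball 0 1) = emeasure lborel (ball (0::complex) 1)"
    by (simp add: emeasure_distr)
qed simp

text \<open>The squared modulus pushes area on the disc to pi times length on [0, 1): the annulus x
  < |z|^2 < 1 has area pi * (1 - x), linear in x, so no Jacobian appears. Comparing the two measures
  on half-lines suffices, as both are finite there.\<close>

lemma nn_integral_disc_radial:
  fixes h :: "real \<Rightarrow> ennreal"
  assumes [measurable]: "h \<in> borel_measurable borel"
  shows "(\<integral>\<^sup>+z. indicator unit_disc z * h ((cmod z)\<^sup>2) \<partial>lborel) =
         ennreal pi * (\<integral>\<^sup>+r. indicator {0..<1} r * h r \<partial>lborel)"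
proof -
  let ?D = "density lborel (indicator unit_disc) :: complex measure"
  let ?M = "distr ?D borel (\<lambda>z. (cmod z)\<^sup>2)"
  let ?N = "density lborel (\<lambda>r. ennreal pi * indicator {0..<1} r) :: real measure"
  have area: "emeasure lborel (ball (0::complex) r) = ennreal (pi * r\<^sup>2)"
    "emeasure lborel (cball (0::complex) r) = ennreal (pi * r\<^sup>2)" if "0 \<le> r" for r
    using that by (simp_all add: emeasure_ball emeasure_cball unit_ball_vol_2)
  have M: "emeasure ?M {x<..} = emeasure lborel (unit_disc \<inter> {z. x < (cmod z)\<^sup>2})" for x
  proof -
    have [measurable]: "{z. x < (cmod z)\<^sup>2} \<in> sets borel" "unit_disc \<in> sets borel" by measurable
    have "emeasure ?M {x<..} = emeasure ?D {z. x < (cmod z)\<^sup>2}"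
      by (subst emeasure_distr) (auto simp: vimage_def)
    also have "\<dots> = (\<integral>\<^sup>+z. indicator unit_disc z * indicator {z. x < (cmod z)\<^sup>2} z \<partial>lborel)"
      by (rule emeasure_density) simp_all
    also have "\<dots> = (\<integral>\<^sup>+z. indicator (unit_disc \<inter> {z. x < (cmod z)\<^sup>2}) z \<partial>lborel)"
      by (rule nn_integral_cong) (auto simp: indicator_def)
    also have "\<dots> = emeasure lborel (unit_disc \<inter> {z. x < (cmod z)\<^sup>2})"
      by simp
    finally show ?thesis .
  qed
  have N: "emeasure ?N {x<..} = ennreal pi * emeasure lborel ({0..<1} \<inter> {x<..})" for x :: real
    by (subst emeasure_density)
       (auto simp: mult.assoc nn_integral_cmult simp flip: indicator_inter_arith)
  have eq: "emeasure ?M {x<..} = emeasure ?N {x<..}" for x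
  proof -
    consider "x < 0" | "0 \<le> x" "x < 1" | "1 \<le> x" by linarith
    then show ?thesis
    proof cases
      case 1
      then have "unit_disc \<inter> {z. x < (cmod z)\<^sup>2} = unit_disc" "{0..<1} \<inter> {x<..} = {0..<1}"
        by (auto intro: less_le_trans)
      then show ?thesis unfolding M N by (simp add: area)
    next
      case 2
      have "x < (cmod z)\<^sup>2 \<longleftrightarrow> sqrt x < cmod z" for z
        using real_sqrt_less_iff[of x "(cmod z)\<^sup>2"] by simp
      then have "unit_disc \<inter> {z. x < (cmod z)\<^sup>2} = unit_disc - cball 0 (sqrt x)"
        by (intro set_eqI) (simp add: not_le)
      then have "emeasure lborel (unit_disc \<inter> {z. x < (cmod z)\<^sup>2}) = ennreal pi - ennreal (pi * x)"
        using 2 by (simp add: emeasure_Diff area cball_subset_ball_iff)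
      also have "\<dots> = ennreal pi * ennreal (1 - x)"
        using 2 by (simp add: ennreal_minus ennreal_mult[symmetric] algebra_simps)
      also have "ennreal (1 - x) = emeasure lborel ({0..<1} \<inter> {x<..})"
      proof -
        have "{0..<1} \<inter> {x<..} = {x<..<1}" using 2 by auto
        then show ?thesis using 2 by simp
      qed
      finally show ?thesis unfolding M N .
    next
      case 3
      have "\<not> x < (cmod z)\<^sup>2" if "z \<in> unit_disc" for z
        using that 3 power_le_one[of "cmod z" 2] by simp
      then have "unit_disc \<inter> {z. x < (cmod z)\<^sup>2} = {}"
        by blast
      moreover have "{0..<1} \<inter> {x<..} = {}" using 3 by auto
      ultimately show ?thesis unfolding M N by simp
    qed
  qed
  have "?M = ?N"
  proof (rule measure_eqI_lessThan)
    show "emeasure ?M {x<..} < \<infinity>" for x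
    proof -
      have "emeasure ?M {x<..} \<le> emeasure lborel unit_disc"
        unfolding M by (intro emeasure_mono) auto
      also have "\<dots> < \<infinity>" by (simp add: area)
      finally show ?thesis .
    qed
  qed (auto simp: eq)
  then have "(\<integral>\<^sup>+r. h r \<partial>?M) = (\<integral>\<^sup>+r. h r \<partial>?N)" by simp
  then show ?thesis
    by (simp add: nn_integral_distr nn_integral_density[of _ lborel] borel_measurable_indicator nn_integral_cmult mult.assoc)
qed

lemma nn_integral_Beta:
  assumes "a > -1"
  shows "(\<integral>\<^sup>+r. indicator {0..<1} r * ennreal (r ^ n * (1 - r) powr a) \<partial>lborel) = ennreal (Beta (real n + 1) (a + 1))"
proof -
  have "((\<lambda>t. t powr real n * (1 - t) powr a) has_integral Beta (real n + 1) (a + 1)) {0..1}"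
    using has_integral_Beta_real[of "real n + 1" "a + 1"] assms by simp
  then have "((\<lambda>r. indicator {0..1} r * (r powr real n * (1 - r) powr a)) has_integral Beta (real n + 1) (a + 1)) UNIV"
    by (subst (asm) has_integral_restrict_UNIV[symmetric]) (simp add: indicator_def of_bool_def if_distrib[of "\<lambda>x. x * _"] cong: if_cong)
  then have "(\<integral>\<^sup>+r. ennreal (indicator {0..1} r * (r powr real n * (1 - r) powr a)) \<partial>lborel) = ennreal (Beta (real n + 1) (a + 1))"
    by (intro nn_integral_has_integral_lborel) auto
  moreover have "(\<integral>\<^sup>+r. indicator {0..<1} r * ennreal (r ^ n * (1 - r) powr a) \<partial>lborel)
     = (\<integral>\<^sup>+r. ennreal (indicator {0..1} r * (r powr real n * (1 - r) powr a)) \<partial>lborel)"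
  proof (intro nn_integral_cong_AE)
    \<comment> \<open>For n = 0 the integrands differ at 0, since \<open>0 ^ 0 = 1\<close> but
      \<open>0 powr 0 = 0\<close>; the endpoints form a null set.\<close>
    have "AE r in lborel. r \<noteq> (0::real)" "AE r in lborel. r \<noteq> (1::real)"
      by (rule AE_lborel_singleton)+
    then show "AE r in lborel. indicator {0..<1} r * ennreal (r ^ n * (1 - r) powr a) =
       ennreal (indicator {0..1} r * (r powr real n * (1 - r) powr a))"
      by eventually_elim (auto simp: indicator_def powr_realpow)
  qed
  ultimately show ?thesis by simp
qed

text \<open>Averaging the integrand over all rotations leaves the integral unchanged and makes the
  integrand radial: by Parseval it becomes a series in powers of |z|^2, whose terms integrate to
  Beta values. Working in \<open>ennreal\<close>, the interchanges need only measurability.\<close>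

lemma nn_integral_disc_norm_square:
  assumes f: "f holomorphic_on unit_disc" and a: "a > -1"
  shows "(\<integral>\<^sup>+z. indicator unit_disc z * ennreal ((cmod (f z))\<^sup>2 * (1 - (cmod z)\<^sup>2) powr a) \<partial>lborel) =
    (\<Sum>n. ennreal (pi * Beta (real n + 1) (a + 1) * (cmod (coef f n))\<^sup>2))"
proof -
  \<comment> \<open>Extension by zero, so that measurability and rotations refer to the whole
    plane.\<close>
  define F where "F z = indicator unit_disc z *\<^sub>R f z" for z
  define G where "G z = indicator unit_disc z * ennreal ((cmod (F z))\<^sup>2 * (1 - (cmod z)\<^sup>2) powr a)" for z
  define T where "T = restrict_space lborel {0..2 * pi}"
  interpret T: finite_measure T
    unfolding T_def by (rule finite_measureI) (simp add: emeasure_restrict_space space_restrict_space)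
  interpret pair_sigma_finite "lborel :: complex measure" T ..
  have [measurable]: "unit_disc \<in> sets borel" by simp
  have [measurable]: "F \<in> borel_measurable borel"
    unfolding F_def by (rule borel_measurable_continuous_on_indicator) (use f holomorphic_on_imp_continuous_on in auto)
  have [measurable]: "G \<in> borel_measurable borel"
    unfolding G_def by measurable
  have [measurable]: "cis \<in> borel_measurable borel"
    by (intro borel_measurable_continuous_onI continuous_intros)
  have [measurable]: "cis \<in> borel_measurable T"
    unfolding T_def by (intro measurable_restrict_space1) simp
  have rot: "(\<integral>\<^sup>+z. G (cis t * z) \<partial>lborel) = (\<integral>\<^sup>+z. G z \<partial>lborel)" for t
    by (subst (2) distr_lborel_mult_unit[of "cis t", symmetric]) (simp_all add: nn_integral_distr)
  have GF: "G z = indicator unit_disc z * ennreal ((cmod (f z))\<^sup>2 * (1 - (cmod z)\<^sup>2) powr a)" for z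
    by (auto simp: G_def F_def indicator_def)
  have circ: "(\<integral>\<^sup>+t. G (cis t * z) \<partial>T) =
      (\<Sum>n. indicator unit_disc z * ennreal (2 * pi * (cmod (coef f n))\<^sup>2) * ennreal (((cmod z)\<^sup>2) ^ n * (1 - (cmod z)\<^sup>2) powr a))" for z
  proof (cases "cmod z < 1")
    case True
    note p = circle_parseval[OF f True, folded T_def]
    have sums: "(\<lambda>n. 2 * pi * (cmod (coef f n))\<^sup>2 * ((cmod z)\<^sup>2) ^ n) sums (LINT t|T. (cmod (f (z * cis t)))\<^sup>2)"
      using sums_mult[OF p(2)[unfolded power_mult], of "2 * pi"] by (simp add: mult_ac)
    have "(\<integral>\<^sup>+t. G (cis t * z) \<partial>T) = (\<integral>\<^sup>+t. ennreal ((cmod (f (z * cis t)))\<^sup>2) * ennreal ((1 - (cmod z)\<^sup>2) powr a) \<partial>T)"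
      using True by (intro nn_integral_cong) (auto simp: GF norm_mult ennreal_mult mult.commute)
    also have "\<dots> = (\<integral>\<^sup>+t. ennreal ((cmod (f (z * cis t)))\<^sup>2) \<partial>T) * ennreal ((1 - (cmod z)\<^sup>2) powr a)"
      by (rule nn_integral_multc) (use p(1) in \<open>auto intro: borel_measurable_integrable\<close>)
    also have "(\<integral>\<^sup>+t. ennreal ((cmod (f (z * cis t)))\<^sup>2) \<partial>T) = ennreal (LINT t|T. (cmod (f (z * cis t)))\<^sup>2)"
      by (rule nn_integral_eq_integral[OF p(1)]) simp
    also have "\<dots> = (\<Sum>n. ennreal (2 * pi * (cmod (coef f n))\<^sup>2 * ((cmod z)\<^sup>2) ^ n))"
      using sums by (subst suminf_ennreal2) (auto simp: sums_iff)
    also have "\<dots> * ennreal ((1 - (cmod z)\<^sup>2) powr a) = (\<Sum>n. ennreal (2 * pi * (cmod (coef f n))\<^sup>2 * ((cmod z)\<^sup>2) ^ n) * ennreal ((1 - (cmod z)\<^sup>2) powr a))"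
      by simp
    finally show ?thesis
      using True by (simp add: ennreal_mult mult_ac)
  qed (auto simp: GF norm_mult)
  \<comment> \<open>The factor 2 * pi is the total mass of \<open>T\<close>; it is cancelled at the
    end.\<close>
  have "ennreal (2 * pi) * (\<integral>\<^sup>+z. G z \<partial>lborel) = (\<integral>\<^sup>+t. (\<integral>\<^sup>+z. G (cis t * z) \<partial>lborel) \<partial>T)"
    unfolding rot by (simp add: T_def emeasure_restrict_space space_restrict_space mult.commute)
  also have "\<dots> = (\<integral>\<^sup>+z. (\<integral>\<^sup>+t. G (cis t * z) \<partial>T) \<partial>lborel)"
    by (rule Fubini') measurable
  also have "\<dots> = (\<Sum>n. \<integral>\<^sup>+z. indicator unit_disc z * ennreal (2 * pi * (cmod (coef f n))\<^sup>2) * ennreal (((cmod z)\<^sup>2) ^ n * (1 - (cmod z)\<^sup>2) powr a) \<partial>lborel)"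
    unfolding circ by (rule nn_integral_suminf) measurable
  also have "\<dots> = (\<Sum>n. ennreal (2 * pi) * ennreal (pi * Beta (real n + 1) (a + 1) * (cmod (coef f n))\<^sup>2))"
  proof (rule suminf_cong)
    fix n
    have "(\<integral>\<^sup>+z. indicator unit_disc z * ennreal (2 * pi * (cmod (coef f n))\<^sup>2) * ennreal (((cmod z)\<^sup>2) ^ n * (1 - (cmod z)\<^sup>2) powr a) \<partial>lborel)
       = ennreal (2 * pi * (cmod (coef f n))\<^sup>2) * (\<integral>\<^sup>+z. indicator unit_disc z * ennreal (((cmod z)\<^sup>2) ^ n * (1 - (cmod z)\<^sup>2) powr a) \<partial>lborel)"
      by (subst nn_integral_cmult[symmetric]) (auto simp: mult_ac)
    also have "\<dots> = ennreal (2 * pi * (cmod (coef f n))\<^sup>2) * (ennreal pi * ennreal (Beta (real n + 1) (a + 1)))"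
      by (subst nn_integral_disc_radial[of "\<lambda>r. ennreal (r ^ n * (1 - r) powr a)"]) (simp_all add: nn_integral_Beta[OF a])
    also have "\<dots> = ennreal (2 * pi) * ennreal (pi * Beta (real n + 1) (a + 1) * (cmod (coef f n))\<^sup>2)"
      by (simp add: ennreal_mult'[symmetric] ennreal_mult''[symmetric] mult_ac)
    finally show "(\<integral>\<^sup>+z. indicator unit_disc z * ennreal (2 * pi * (cmod (coef f n))\<^sup>2) * ennreal (((cmod z)\<^sup>2) ^ n * (1 - (cmod z)\<^sup>2) powr a) \<partial>lborel)
       = ennreal (2 * pi) * ennreal (pi * Beta (real n + 1) (a + 1) * (cmod (coef f n))\<^sup>2)" .
  qed
  also have "\<dots> = ennreal (2 * pi) * (\<Sum>n. ennreal (pi * Beta (real n + 1) (a + 1) * (cmod (coef f n))\<^sup>2))"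
    by simp
  finally have "(\<integral>\<^sup>+z. G z \<partial>lborel) = (\<Sum>n. ennreal (pi * Beta (real n + 1) (a + 1) * (cmod (coef f n))\<^sup>2))"
    unfolding ennreal_mult_cancel_left by auto
  then show ?thesis unfolding GF .
qed

text \<open>The squared Bergman norm of \<open>z ^ n\<close>: the Beta value is the integral of r ^
  n * (1 - r) powr a over [0, 1), with r the squared modulus, and \<open>a + 1\<close> is the
  normalisation of \<open>bergman_norm\<close>.\<close>

definition bergman_weight :: "real \<Rightarrow> nat \<Rightarrow> real" where
  "bergman_weight a n = (a + 1) * Beta (real n + 1) (a + 1)"

lemma bergman_weight_pos: "a > -1 \<Longrightarrow> bergman_weight a n > 0"
  unfolding bergman_weight_def Beta_def by (intro mult_pos_pos divide_pos_pos Gamma_real_pos) auto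

text \<open>One identity in \<open>ennreal\<close> serves both claims: its finiteness is membership,
  its real value gives the norm. The factor pi / (a + 1) relates the unnormalised integral to
  \<open>bergman_weight\<close>.\<close>

lemma bergman_space_norm:
  assumes f: "f holomorphic_on unit_disc" and a: "a > -1"
  shows "f \<in> bergman_space a \<longleftrightarrow> summable (\<lambda>n. bergman_weight a n * (cmod (coef f n))\<^sup>2)" (is ?A)
    and "f \<in> bergman_space a \<Longrightarrow> bergman_norm a f = sqrt (\<Sum>n. bergman_weight a n * (cmod (coef f n))\<^sup>2)" (is "_ \<Longrightarrow> ?B")
proof -
  let ?u = "\<lambda>z. indicator unit_disc z *\<^sub>R ((cmod (f z))\<^sup>2 * (1 - (cmod z)\<^sup>2) powr a)"
  let ?v = "\<lambda>n. pi * Beta (real n + 1) (a + 1) * (cmod (coef f n))\<^sup>2"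
  have v: "?v n = pi / (a + 1) * (bergman_weight a n * (cmod (coef f n))\<^sup>2)" for n
    using a by (simp add: bergman_weight_def)
  have v0: "0 \<le> ?v n" for n
    unfolding v using bergman_weight_pos[OF a, of n] a by simp
  have meas: "?u \<in> borel_measurable borel"
  proof -
    have "(\<lambda>z. indicator unit_disc z *\<^sub>R f z) \<in> borel_measurable borel"
      by (rule borel_measurable_continuous_on_indicator) (use f holomorphic_on_imp_continuous_on in auto)
    then have "(\<lambda>z. (cmod (indicator unit_disc z *\<^sub>R f z))\<^sup>2 * (1 - (cmod z)\<^sup>2) powr a) \<in> borel_measurable borel"
      by measurable
    also have "(\<lambda>z. (cmod (indicator unit_disc z *\<^sub>R f z))\<^sup>2 * (1 - (cmod z)\<^sup>2) powr a) = ?u"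
      by (auto simp: indicator_def)
    finally show ?thesis .
  qed
  have nn: "(\<integral>\<^sup>+z. ennreal (?u z) \<partial>lborel) = (\<Sum>n. ennreal (?v n))"
    unfolding nn_integral_disc_norm_square[OF f a, symmetric]
    by (intro nn_integral_cong) (auto simp: indicator_def)
  have "f \<in> bergman_space a \<longleftrightarrow> integrable lborel ?u"
    by (simp add: bergman_space_def set_integrable_def f)
  also have "\<dots> \<longleftrightarrow> (\<integral>\<^sup>+z. ennreal (?u z) \<partial>lborel) < \<infinity>"
    unfolding integrable_iff_bounded using meas by simp
  also have "\<dots> \<longleftrightarrow> summable ?v"
  proof
    assume "(\<integral>\<^sup>+z. ennreal (?u z) \<partial>lborel) < \<infinity>"
    then show "summable ?v"
      unfolding nn by (intro summable_suminf_not_top v0) auto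
  next
    assume "summable ?v"
    from suminf_ennreal2[OF v0 this] show "(\<integral>\<^sup>+z. ennreal (?u z) \<partial>lborel) < \<infinity>"
      unfolding nn by simp
  qed
  finally have mem: "f \<in> bergman_space a \<longleftrightarrow> summable ?v" .
  then show ?A
    unfolding v using a by (subst (asm) summable_cmult_iff) auto
  assume "f \<in> bergman_space a"
  then have s: "summable ?v" using mem by simp
  have "(LINT z|lborel. ?u z) = enn2real (\<integral>\<^sup>+z. ennreal (?u z) \<partial>lborel)"
    by (rule integral_eq_nn_integral) (use meas in simp_all)
  also have "\<dots> = (\<Sum>n. ?v n)"
    unfolding nn by (subst suminf_ennreal2[OF v0 s]) (simp add: suminf_nonneg[OF s v0])
  also have "\<dots> = pi / (a + 1) * (\<Sum>n. bergman_weight a n * (cmod (coef f n))\<^sup>2)"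
    unfolding v using \<open>?A\<close> \<open>f \<in> bergman_space a\<close> by (subst suminf_mult) auto
  finally show ?B
    unfolding bergman_norm_def set_lebesgue_integral_def using a by simp
qed

subsection \<open>Estimates for the kernel\<close>

lemma powr_step_mvt:
  fixes x p :: real
  assumes "0 < x"
  obtains z where "x < z" "z < x + 1" "(x + 1) powr p - x powr p = p * z powr (p - 1)"
proof -
  have "\<exists>z>x. z < x + 1 \<and> (x + 1) powr p - x powr p = (x + 1 - x) * (p * z powr (p - 1))"
    by (rule MVT2) (use assms in \<open>auto intro!: derivative_eq_intros simp: field_simps\<close>)
  then show ?thesis using that by auto
qed

lemma powr_step_pos:
  fixes x q :: real
  assumes "0 \<le> x" "0 < q" "q \<le> 1"
  shows "q * (x + 1) powr (q - 1) \<le> (x + 1) powr q - x powr q"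
proof (cases "x = 0")
  case False
  with assms obtain z where z: "x < z" "z < x + 1" "(x + 1) powr q - x powr q = q * z powr (q - 1)"
    using powr_step_mvt[of x q] by auto
  have "(x + 1) powr (q - 1) \<le> z powr (q - 1)"
    using powr_mono2'[of "q - 1" z "x + 1"] z assms by simp
  then show ?thesis using z assms by simp
qed (use assms in simp)

lemma powr_step_neg:
  fixes x q :: real
  assumes "0 < x" "0 < q"
  shows "q * (x + 1) powr (- q - 1) \<le> x powr (- q) - (x + 1) powr (- q)"
proof -
  obtain z where z: "x < z" "z < x + 1" "(x + 1) powr (- q) - x powr (- q) = - q * z powr (- q - 1)"
    using powr_step_mvt[OF assms(1), of "- q"] by metis
  have "(x + 1) powr (- q - 1) \<le> z powr (- q - 1)"
    using powr_mono2'[of "- q - 1" z "x + 1"] z assms by simp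
  then have "q * (x + 1) powr (- q - 1) \<le> q * z powr (- q - 1)" using assms by simp
  then show ?thesis using z(3) by linarith
qed

text \<open>For s <= 0 the terms increase, so each is at most n powr (-s), with constant 1. For s >
  0 \<open>powr_step_pos\<close> with q = 1 - s telescopes, with constant 1 / (1 - s). The maximum
  covers both cases.\<close>

lemma sum_powr_le:
  fixes s :: real
  assumes "s < 1"
  shows "(\<Sum>k<n. (real k + 1) powr (- s)) \<le> max 1 (1 / (1 - s)) * real n powr (1 - s)"
proof (cases "s \<le> 0")
  case True
  have "(\<Sum>k<n. (real k + 1) powr (- s)) \<le> (\<Sum>k<n. real n powr (- s))"
    by (intro sum_mono powr_mono2) (use True in auto)
  also have "\<dots> = 1 * real n powr (1 - s)"
    by (cases "n = 0") (simp_all add: powr_diff powr_minus field_simps)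
  also have "\<dots> \<le> max 1 (1 / (1 - s)) * real n powr (1 - s)"
    by (intro mult_right_mono) auto
  finally show ?thesis .
next
  case False
  have "(\<Sum>k<n. (real k + 1) powr (- s)) \<le> (\<Sum>k<n. (1 / (1 - s)) * (real (Suc k) powr (1 - s) - real k powr (1 - s)))"
  proof (rule sum_mono)
    fix k
    have "(1 - s) * (real k + 1) powr (- s) \<le> (real k + 1) powr (1 - s) - real k powr (1 - s)"
      using powr_step_pos[of "real k" "1 - s"] False assms by simp
    then show "(real k + 1) powr (- s) \<le> (1 / (1 - s)) * (real (Suc k) powr (1 - s) - real k powr (1 - s))"
      using assms by (simp add: field_simps)
  qed
  also have "\<dots> = 1 / (1 - s) * (real n powr (1 - s))"
    unfolding sum_distrib_left[symmetric]
      sum_lessThan_telescope[of "\<lambda>k. real k powr (1 - s)"] by simp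
  also have "\<dots> \<le> max 1 (1 / (1 - s)) * real n powr (1 - s)"
    by (intro mult_right_mono) auto
  finally show ?thesis .
qed

text \<open>Telescoping through \<open>powr_step_neg\<close> with q = 1 + s. The bound is uniform in
  \<open>K\<close>, hence controls the infinite tail.\<close>

lemma sum_powr_tail_le:
  fixes s :: real
  assumes "-1 < s"
  shows "(\<Sum>j<K. (real (n + j) + 2) powr (- s - 2)) \<le> 1 / (1 + s) * (real n + 1) powr (- 1 - s)"
proof -
  have "(\<Sum>j<K. (real (n + j) + 2) powr (- s - 2)) \<le>
      (\<Sum>j<K. (1 / (1 + s)) * ((real (n + j) + 1) powr (- 1 - s) - (real (n + Suc j) + 1) powr (- 1 - s)))"
  proof (rule sum_mono)
    fix j
    show "(real (n + j) + 2) powr (- s - 2) \<le> (1 / (1 + s)) * ((real (n + j) + 1) powr (- 1 - s) - (real (n + Suc j) + 1) powr (- 1 - s))"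
      using powr_step_neg[of "real (n + j) + 1" "1 + s"] assms by (simp add: field_simps)
  qed
  also have "\<dots> = 1 / (1 + s) * ((real n + 1) powr (- 1 - s) - (real (n + K) + 1) powr (- 1 - s))"
    unfolding sum_distrib_left[symmetric]
      sum_lessThan_telescope'[of "\<lambda>j. (real (n + j) + 1) powr (- 1 - s)"] by simp
  also have "\<dots> \<le> 1 / (1 + s) * (real n + 1) powr (- 1 - s)"
    using assms by (intro mult_left_mono) auto
  finally show ?thesis .
qed

text \<open>The sum is split at k = m. Up to there the denominator is at least (m + 1)^2 and
  \<open>sum_powr_le\<close> applies; beyond, it is at least (k + 1)^2 and
  \<open>sum_powr_tail_le\<close> applies.\<close>

lemma sum_powr_hilbert_kernel_le:
  fixes s :: real
  assumes "-1 < s" "s < 1"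
  shows "(\<Sum>k<K. (real k + 1) powr (- s) / (real m + real k + 1)\<^sup>2) \<le>
    (max 1 (1 / (1 - s)) + 1 / (1 + s)) * (real m + 1) powr (- 1 - s)"
proof -
  let ?t = "\<lambda>k. (real k + 1) powr (- s) / (real m + real k + 1)\<^sup>2"
  \<comment> \<open>Enlarging the range makes the split at \<open>Suc m\<close> possible for every
    \<open>K\<close>.\<close>
  have "(\<Sum>k<K. ?t k) \<le> (\<Sum>k<Suc m + K. ?t k)"
    by (rule sum_mono2) auto
  also have "\<dots> = (\<Sum>k<Suc m. ?t k) + (\<Sum>j<K. ?t (Suc m + j))"
    by (induction K) (simp_all del: sum.lessThan_Suc add: sum.lessThan_Suc[of _ "_ + _"] sum.lessThan_Suc[of _ K for K])
  also have "(\<Sum>k<Suc m. ?t k) \<le> (\<Sum>k<Suc m. (real k + 1) powr (- s) / (real m + 1)\<^sup>2)"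
    by (intro sum_mono divide_left_mono power_mono) auto
  also have "\<dots> \<le> (max 1 (1 / (1 - s)) * real (Suc m) powr (1 - s)) / (real m + 1)\<^sup>2"
    unfolding sum_divide_distrib[symmetric] by (intro divide_right_mono sum_powr_le assms) auto
  also have "\<dots> = max 1 (1 / (1 - s)) * (real m + 1) powr (- 1 - s)"
  proof -
    have "real (Suc m) powr (1 - s) / (real m + 1)\<^sup>2 = (real m + 1) powr (1 - s) / (real m + 1) powr 2"
      by (simp add: add.commute)
    also have "\<dots> = (real m + 1) powr (- 1 - s)"
      using powr_diff[of "real m + 1" "1 - s" 2] by simp
    finally show ?thesis by (simp only: times_divide_eq_right[symmetric])
  qed
  also have "(\<Sum>j<K. ?t (Suc m + j)) \<le> (\<Sum>j<K. (real (m + j) + 2) powr (- s - 2))"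
  proof (rule sum_mono)
    fix j
    have "?t (Suc m + j) \<le> (real (m + j) + 2) powr (- s) / (real (m + j) + 2)\<^sup>2"
      by (rule frac_le) (auto intro!: power_mono simp: add_ac)
    also have "\<dots> = (real (m + j) + 2) powr (- s) / (real (m + j) + 2) powr 2"
      by simp
    also have "\<dots> = (real (m + j) + 2) powr (- s - 2)"
      by (rule powr_diff[symmetric])
    finally show "?t (Suc m + j) \<le> (real (m + j) + 2) powr (- s - 2)" .
  qed
  also have "\<dots> \<le> 1 / (1 + s) * (real m + 1) powr (- 1 - s)"
    by (rule sum_powr_tail_le) (use assms in simp)
  finally show ?thesis by (simp add: algebra_simps)
qed


subsection \<open>Moments\<close>

definition moment :: "(complex \<Rightarrow> complex) \<Rightarrow> nat \<Rightarrow> complex" where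
  "moment f m = (LINT t:{0..<1::real}|lborel. f (of_real t) * of_real t ^ m)"

lemma integrable_power_unit:
  "integrable (restrict_space lborel {0..<1::real}) (\<lambda>t. t ^ j)"
  "(LINT t|restrict_space lborel {0..<1::real}. t ^ j) = 1 / (real j + 1)"
proof -
  have int: "set_integrable lborel {0..1} (\<lambda>t::real. t ^ j)"
    unfolding set_integrable_def by (rule borel_integrable_compact) (auto intro!: continuous_intros)
  have sub: "set_integrable lborel {0..<1} (\<lambda>t::real. t ^ j)"
    by (rule set_integrable_subset[OF int]) auto
  then show "integrable (restrict_space lborel {0..<1::real}) (\<lambda>t. t ^ j)"
    by (simp add: integrable_restrict_space set_integrable_def)
  have "((\<lambda>t. t ^ j) has_integral (1 ^ Suc j / real (Suc j) - 0 ^ Suc j / real (Suc j))) {0..1::real}"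
    by (rule fundamental_theorem_of_calculus)
       (auto intro!: derivative_eq_intros simp flip: has_real_derivative_iff_has_vector_derivative simp del: power_Suc of_nat_Suc)
  then have "((\<lambda>t. t ^ j) has_integral 1 / (real j + 1)) {0..<1::real}"
    by (subst has_integral_spike_set_eq[where T="{0..1}"])
       (auto simp: add.commute intro: negligible_subset[of "{1}"])
  then have "integral {0..<1} (\<lambda>t::real. t ^ j) = 1 / (real j + 1)"
    by (rule integral_unique)
  with set_borel_integral_eq_integral(2)[OF sub]
  show "(LINT t|restrict_space lborel {0..<1::real}. t ^ j) = 1 / (real j + 1)"
    by (simp add: integral_restrict_space set_lebesgue_integral_def)
qed

text \<open>The hypothesis says that the integrals of |coef f k| * t ^ k over [0, 1) have a finite
  sum, which justifies termwise integration; the factor t ^ m only makes the terms smaller.\<close>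

lemma moment_sums:
  assumes f: "f holomorphic_on unit_disc" and s: "summable (\<lambda>k. cmod (coef f k) / (real k + 1))"
  defines "M \<equiv> restrict_space lborel {0..<1::real}"
  shows "integrable M (\<lambda>t. f (of_real t) * of_real t ^ m)"
    and "(\<lambda>k. coef f k / of_nat (m + k + 1)) sums moment f m"
proof -
  let ?u = "\<lambda>k t. coef f k * of_real (t ^ (k + m))"
  have space: "space M = {0..<1}" by (simp add: M_def space_restrict_space)
  have u: "(\<lambda>k. ?u k t) sums (f (of_real t) * of_real t ^ m)" if "t \<in> space M" for t
    using sums_mult2[OF coef_sums[OF f, of "of_real t"], of "of_real t ^ m"] that
    by (simp add: space power_add mult.assoc)
  have 1: "integrable M (?u k)" for k
    using integrable_power_unit(1)[of "k + m"]
    unfolding M_def by (intro integrable_mult_right integrable_of_real)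
  have 2: "AE t in M. summable (\<lambda>k. norm (?u k t))"
  proof (rule AE_I2)
    fix t assume "t \<in> space M"
    then have t: "0 \<le> t" "t < 1" by (auto simp: space)
    have "summable (\<lambda>k. cmod (coef f k) * t ^ k * t ^ m)"
      by (intro summable_mult2 coef_norm_summable[OF f t])
    then show "summable (\<lambda>k. norm (?u k t))"
      using t by (simp add: norm_mult power_add mult.assoc norm_power)
  qed
  have "(LINT t|M. norm (?u k t)) = cmod (coef f k) * (LINT t|M. t ^ (k + m))" for k
  proof -
    have "(LINT t|M. norm (?u k t)) = (LINT t|M. cmod (coef f k) * t ^ (k + m))"
      by (rule Bochner_Integration.integral_cong) (auto simp: space norm_mult norm_power)
    then show ?thesis by simp
  qed
  then have n: "(LINT t|M. norm (?u k t)) = cmod (coef f k) * (1 / (real (k + m) + 1))" for k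
    using integrable_power_unit(2)[of "k + m"] by (simp add: M_def)
  have 3: "summable (\<lambda>k. LINT t|M. norm (?u k t))"
    unfolding n by (rule summable_comparison_test'[OF s, of 0]) (auto intro!: divide_left_mono)
  have eq: "t \<in> space M \<Longrightarrow> (\<Sum>k. ?u k t) = f (of_real t) * of_real t ^ m" for t
    using u by (simp add: sums_iff)
  show "integrable M (\<lambda>t. f (of_real t) * of_real t ^ m)"
    using integrable_suminf[OF 1 2 3] by (subst Bochner_Integration.integrable_cong[OF refl eq[symmetric]])
  have "(LINT t|M. (\<Sum>k. ?u k t)) = (LINT t|M. f (of_real t) * of_real t ^ m)"
    by (rule Bochner_Integration.integral_cong[OF refl eq])
  also have "\<dots> = moment f m"
    unfolding M_def moment_def set_lebesgue_integral_def by (simp add: integral_restrict_space)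
  finally have 4: "(LINT t|M. (\<Sum>k. ?u k t)) = moment f m" .
  have "integral\<^sup>L M (?u k) = coef f k / of_nat (m + k + 1)" for k
  proof -
    have "integral\<^sup>L M (?u k) = coef f k * of_real (LINT t|M. t ^ (k + m))"
      by (simp only: integral_mult_right_zero integral_complex_of_real)
    also have "\<dots> = coef f k * of_real (1 / (real (k + m) + 1))"
      using integrable_power_unit(2)[of "k + m"] by (simp add: M_def)
    also have "\<dots> = coef f k / of_nat (m + k + 1)" by (simp add: add_ac)
    finally show ?thesis .
  qed
  then show "(\<lambda>k. coef f k / of_nat (m + k + 1)) sums moment f m"
    using sums_integral[OF 1 2 3] unfolding 4 by simp
qed

text \<open>Expanding g'(tz) in powers of tz and integrating termwise produces the moments. Since t
  ^ m <= 1 and \<open>f\<close> is integrable on [0, 1), the integrals of the norms are dominated by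
  |coef (deriv g) m| * |z| ^ m, which is summable for |z| < 1.\<close>

lemma generalized_hilbert_coef:
  assumes f: "f holomorphic_on unit_disc" and s: "summable (\<lambda>k. cmod (coef f k) / (real k + 1))"
    and g: "g holomorphic_on unit_disc"
  shows "generalized_hilbert g f holomorphic_on unit_disc"
    and "coef (generalized_hilbert g f) m = coef (deriv g) m * moment f m"
proof -
  let ?M = "restrict_space lborel {0..<1::real}"
  have g': "deriv g holomorphic_on unit_disc"
    using g by (intro holomorphic_deriv) auto
  have space: "space ?M = {0..<1}" by (simp add: space_restrict_space)
  have intf: "integrable ?M (\<lambda>t. f (of_real t))"
    using moment_sums(1)[OF f s, of 0] by simp
  have main: "(\<lambda>m. coef (deriv g) m * moment f m * z ^ m) sums generalized_hilbert g f z" if z: "cmod z < 1" for z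
  proof -
    let ?u = "\<lambda>m t. coef (deriv g) m * z ^ m * (f (of_real t) * of_real t ^ m)"
    have tz: "cmod (of_real t * z) < 1" if "t \<in> space ?M" for t
    proof -
      have "cmod (of_real t * z) \<le> cmod z"
        using that by (auto simp: space norm_mult intro: mult_left_le_one_le)
      then show ?thesis using z by simp
    qed
    have u: "(\<lambda>m. ?u m t) sums (f (of_real t) * deriv g (of_real t * z))" if "t \<in> space ?M" for t
      using sums_mult[OF coef_sums[OF g' tz[OF that]], of "f (of_real t)"]
      by (simp add: power_mult_distrib mult_ac)
    have 1: "integrable ?M (?u m)" for m
      by (intro integrable_mult_right moment_sums(1)[OF f s])
    have bound: "norm (?u m t) \<le> cmod (coef (deriv g) m) * cmod z ^ m * cmod (f (of_real t))" if "t \<in> space ?M" for m t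
    proof -
      have "cmod (f (of_real t)) * t ^ m \<le> cmod (f (of_real t)) * 1"
        using that by (intro mult_left_mono power_le_one) (auto simp: space)
      then show ?thesis
        using that by (auto simp: space norm_mult norm_power intro!: mult_left_mono)
    qed
    have sg: "summable (\<lambda>m. cmod (coef (deriv g) m) * cmod z ^ m * c)" for c
      by (intro summable_mult2 coef_norm_summable[OF g']) (use z in auto)
    have 2: "AE t in ?M. summable (\<lambda>m. norm (?u m t))"
      by (rule AE_I2, rule summable_comparison_test'[OF sg, of 0]) (use bound in auto)
    have 3: "summable (\<lambda>m. LINT t|?M. norm (?u m t))"
    proof (rule summable_comparison_test'[OF sg, of 0])
      fix m
      have "norm (LINT t|?M. norm (?u m t)) = (LINT t|?M. norm (?u m t))"
        by (simp add: integral_nonneg)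
      also have "\<dots> \<le> (LINT t|?M. cmod (coef (deriv g) m) * cmod z ^ m * cmod (f (of_real t)))"
        by (intro integral_mono integrable_norm 1 integrable_mult_right intf bound)
      also have "\<dots> = cmod (coef (deriv g) m) * cmod z ^ m * (LINT t|?M. cmod (f (of_real t)))"
        by simp
      finally show "norm (LINT t|?M. norm (?u m t)) \<le> cmod (coef (deriv g) m) * cmod z ^ m * (LINT t|?M. cmod (f (of_real t)))" .
    qed
    have "(LINT t|?M. (\<Sum>m. ?u m t)) = (LINT t|?M. f (of_real t) * deriv g (of_real t * z))"
      by (rule Bochner_Integration.integral_cong) (use u in \<open>auto simp: sums_iff\<close>)
    also have "\<dots> = generalized_hilbert g f z"
      unfolding generalized_hilbert_def set_lebesgue_integral_def by (simp add: integral_restrict_space)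
    finally have 4: "(LINT t|?M. (\<Sum>m. ?u m t)) = generalized_hilbert g f z" .
    have 5: "integral\<^sup>L ?M (?u m) = coef (deriv g) m * moment f m * z ^ m" for m
      unfolding integral_mult_right_zero
      by (simp add: moment_def set_lebesgue_integral_def integral_restrict_space mult_ac)
    show ?thesis
      using sums_integral[OF 1 2 3] unfolding 4 5 .
  qed
  show "generalized_hilbert g f holomorphic_on unit_disc"
    by (rule coef_eqI(1)[OF main])
  show "coef (generalized_hilbert g f) m = coef (deriv g) m * moment f m"
    by (rule coef_eqI(2)[OF main])
qed

subsection \<open>Weighted spaces of Taylor coefficients\<close>

text \<open>Two-sided bounds instead of exact powers, because the Bergman weights are Beta values.
  The norm is prescribed only on \<open>H\<close>: elsewhere the concrete norms carry no
  information.\<close>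

locale weighted_taylor_space =
  fixes H :: "(complex \<Rightarrow> complex) set" and N :: "(complex \<Rightarrow> complex) \<Rightarrow> real"
    and w :: "nat \<Rightarrow> real" and s A B :: real
  assumes mem_iff: "f \<in> H \<longleftrightarrow> f holomorphic_on unit_disc \<and> summable (\<lambda>n. w n * (cmod (coef f n))\<^sup>2)"
    and norm_eq: "f \<in> H \<Longrightarrow> N f = sqrt (\<Sum>n. w n * (cmod (coef f n))\<^sup>2)"
    and s: "-1 < s" "s < 1" and A: "0 < A"
    and lower: "A * (real n + 1) powr s \<le> w n"
    and upper: "w n \<le> B * (real n + 1) powr s"
begin

lemma w_pos: "0 < w n"
proof -
  have "0 < A * (real n + 1) powr s" using A by simp
  then show ?thesis using lower[of n] by linarith
qed

lemma w_nonneg: "0 \<le> w n" using w_pos less_imp_le by blast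

lemma memD:
  assumes "f \<in> H"
  shows "f holomorphic_on unit_disc" "summable (\<lambda>n. w n * (cmod (coef f n))\<^sup>2)"
  using assms mem_iff by auto

lemma norm_square:
  assumes "f \<in> H"
  shows "(\<lambda>n. w n * (cmod (coef f n))\<^sup>2) sums (N f)\<^sup>2" "0 \<le> N f"
proof -
  have "0 \<le> (\<Sum>n. w n * (cmod (coef f n))\<^sup>2)"
    by (intro suminf_nonneg memD(2) assms mult_nonneg_nonneg w_nonneg) auto
  then show "(\<lambda>n. w n * (cmod (coef f n))\<^sup>2) sums (N f)\<^sup>2" "0 \<le> N f"
    using memD(2)[OF assms] norm_eq[OF assms] by (auto simp: sums_iff)
qed

lemma coef_add_mult:
  assumes "f \<in> H" "h \<in> H"
  shows "coef (\<lambda>z. f z + c * h z) n = coef f n + c * coef h n"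
  using coef_lincomb[OF memD(1)[OF assms(1)] memD(1)[OF assms(2)], of 1 c] by simp

lemma lincomb_mem:
  assumes "f \<in> H" "h \<in> H"
  shows "(\<lambda>z. a * f z + b * h z) \<in> H"
  unfolding mem_iff
proof
  note f = memD[OF assms(1)] and h = memD[OF assms(2)]
  show "(\<lambda>z. a * f z + b * h z) holomorphic_on unit_disc"
    by (intro holomorphic_intros f h)
  show "summable (\<lambda>n. w n * (cmod (coef (\<lambda>z. a * f z + b * h z) n))\<^sup>2)"
  proof (rule summable_comparison_test'[of "\<lambda>n. 2 * (cmod a)\<^sup>2 * (w n * (cmod (coef f n))\<^sup>2) + 2 * (cmod b)\<^sup>2 * (w n * (cmod (coef h n))\<^sup>2)" 0])
    show "summable (\<lambda>n. 2 * (cmod a)\<^sup>2 * (w n * (cmod (coef f n))\<^sup>2) + 2 * (cmod b)\<^sup>2 * (w n * (cmod (coef h n))\<^sup>2))"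
      by (intro summable_add summable_mult f h)
    fix n
    let ?x = "cmod a * cmod (coef f n)" and ?y = "cmod b * cmod (coef h n)"
    have "(cmod (a * coef f n + b * coef h n))\<^sup>2 \<le> (?x + ?y)\<^sup>2"
      by (intro power_mono) (auto simp: norm_mult intro: norm_triangle_le)
    also have "\<dots> \<le> 2 * ?x\<^sup>2 + 2 * ?y\<^sup>2"
      using sum_squares_bound[of ?x ?y] by (simp add: power2_sum)
    finally have "w n * (cmod (a * coef f n + b * coef h n))\<^sup>2 \<le> w n * (2 * ?x\<^sup>2 + 2 * ?y\<^sup>2)"
      by (intro mult_left_mono w_nonneg)
    then show "norm (w n * (cmod (coef (\<lambda>z. a * f z + b * h z) n))\<^sup>2) \<le> 2 * (cmod a)\<^sup>2 * (w n * (cmod (coef f n))\<^sup>2) + 2 * (cmod b)\<^sup>2 * (w n * (cmod (coef h n))\<^sup>2)"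
      using w_nonneg[of n] by (simp add: coef_lincomb f h power_mult_distrib algebra_simps)
  qed
qed

lemma add_mult_mem: "f \<in> H \<Longrightarrow> h \<in> H \<Longrightarrow> (\<lambda>z. f z + c * h z) \<in> H"
  using lincomb_mem[of f h 1 c] by simp

section \<open>Inner product and Parseval's identity for orthonormal bases\<close>

definition ip :: "(complex \<Rightarrow> complex) \<Rightarrow> (complex \<Rightarrow> complex) \<Rightarrow> complex" where
  "ip f h = (\<Sum>n. of_real (w n) * (coef f n * cnj (coef h n)))"

lemma ip_sums:
  assumes "f \<in> H" "h \<in> H"
  shows "(\<lambda>n. of_real (w n) * (coef f n * cnj (coef h n))) sums ip f h"
proof -
  have "summable (\<lambda>n. of_real (w n) * (coef f n * cnj (coef h n)))"
  proof (rule summable_comparison_test'[of "\<lambda>n. w n * (cmod (coef f n))\<^sup>2 + w n * (cmod (coef h n))\<^sup>2" 0])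
    show "summable (\<lambda>n. w n * (cmod (coef f n))\<^sup>2 + w n * (cmod (coef h n))\<^sup>2)"
      by (intro summable_add memD assms)
    fix n
    have "cmod (coef f n) * cmod (coef h n) \<le> (cmod (coef f n))\<^sup>2 + (cmod (coef h n))\<^sup>2"
      using sum_squares_bound[of "cmod (coef f n)" "cmod (coef h n)"]
        mult_nonneg_nonneg[OF norm_ge_zero norm_ge_zero, of "coef f n" "coef h n"]
      unfolding mult.assoc by linarith
    from mult_left_mono[OF this w_nonneg[of n]]
    show "norm (of_real (w n) * (coef f n * cnj (coef h n))) \<le> w n * (cmod (coef f n))\<^sup>2 + w n * (cmod (coef h n))\<^sup>2"
      using w_nonneg[of n] by (simp add: norm_mult algebra_simps)
  qed
  then show ?thesis unfolding ip_def by (rule summable_sums)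
qed

lemma ip_commute:
  assumes "f \<in> H" "h \<in> H"
  shows "ip h f = cnj (ip f h)"
proof -
  have "(\<lambda>n. cnj (of_real (w n) * (coef f n * cnj (coef h n)))) sums cnj (ip f h)"
    using ip_sums[OF assms] by (simp only: sums_cnj)
  then show ?thesis unfolding ip_def by (simp add: sums_iff mult_ac)
qed

lemma ip_add_mult_left:
  assumes "f \<in> H" "h \<in> H" "k \<in> H"
  shows "ip (\<lambda>z. f z + c * h z) k = ip f k + c * ip h k"
proof -
  have "(\<lambda>n. of_real (w n) * (coef f n * cnj (coef k n)) + c * (of_real (w n) * (coef h n * cnj (coef k n))))
      sums (ip f k + c * ip h k)"
    by (intro sums_add sums_mult ip_sums assms)
  then show ?thesis
    unfolding ip_def[of "\<lambda>z. f z + c * h z"] coef_add_mult[OF assms(1,2)]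
    by (simp add: sums_iff algebra_simps)
qed

lemma norm_add_mult:
  assumes "f \<in> H" "h \<in> H"
  shows "(N (\<lambda>z. f z + c * h z))\<^sup>2 = (N f)\<^sup>2 + 2 * Re (cnj c * ip f h) + (cmod c)\<^sup>2 * (N h)\<^sup>2"
proof -
  have "(\<lambda>n. w n * (cmod (coef f n))\<^sup>2 + 2 * Re (cnj c * (of_real (w n) * (coef f n * cnj (coef h n)))) + (cmod c)\<^sup>2 * (w n * (cmod (coef h n))\<^sup>2))
     sums ((N f)\<^sup>2 + 2 * Re (cnj c * ip f h) + (cmod c)\<^sup>2 * (N h)\<^sup>2)"
    by (intro sums_add sums_mult sums_Re norm_square ip_sums assms)
  moreover have "w n * (cmod (coef f n))\<^sup>2 + 2 * Re (cnj c * (of_real (w n) * (coef f n * cnj (coef h n)))) + (cmod c)\<^sup>2 * (w n * (cmod (coef h n))\<^sup>2)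
      = w n * (cmod (coef (\<lambda>z. f z + c * h z) n))\<^sup>2" for n
    unfolding coef_add_mult[OF assms] cmod_power2
    by (simp add: algebra_simps power2_eq_square)
  ultimately show ?thesis
    using norm_square(1)[OF add_mult_mem[OF assms]] sums_unique2 by simp blast
qed

text \<open>In the polarisation sum the squared norms of \<open>f\<close> and \<open>h\<close>
  cancel, since the four powers of \<i> add up to 0; the cross terms reassemble
  \<open>ip f h\<close>.\<close>

lemma inner_of_norm_eq:
  assumes "f \<in> H" "h \<in> H"
  shows "inner_of_norm N f h = ip f h"
proof -
  have "(\<Sum>k<4. \<i> ^ k * of_real ((N (\<lambda>z. f z + \<i> ^ k * h z))\<^sup>2)) = 4 * ip f h"
    unfolding norm_add_mult[OF assms]
    by (simp add: numeral_eq_Suc complex_eq_iff)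
  then show ?thesis by (simp add: inner_of_norm_def)
qed

lemma cauchy_schwarz:
  assumes "f \<in> H" "h \<in> H" "0 < (N h)\<^sup>2"
  shows "(cmod (ip f h))\<^sup>2 \<le> (N f)\<^sup>2 * (N h)\<^sup>2"
proof -
  let ?p = "ip f h" and ?h = "(N h)\<^sup>2"
  \<comment> \<open>The multiple of \<open>h\<close> is chosen to minimise the norm: what is left of
    \<open>f\<close> is orthogonal to \<open>h\<close>.\<close>
  have "0 \<le> (N (\<lambda>z. f z + (- ?p / of_real ?h) * h z))\<^sup>2" by simp
  also have "\<dots> = (N f)\<^sup>2 + 2 * Re (cnj (- ?p / of_real ?h) * ?p) + (cmod (- ?p / of_real ?h))\<^sup>2 * ?h"
    by (rule norm_add_mult[OF assms(1,2)])
  also have "Re (cnj (- ?p / of_real ?h) * ?p) = - (cmod ?p)\<^sup>2 / ?h"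
  proof -
    have "cnj (- ?p / of_real ?h) * ?p = - (?p * cnj ?p) / of_real ?h" by simp
    also have "\<dots> = of_real (- (cmod ?p)\<^sup>2 / ?h)" unfolding complex_norm_square[symmetric] by simp
    finally show ?thesis by (simp only: Re_complex_of_real)
  qed
  also have "(cmod (- ?p / of_real ?h))\<^sup>2 * ?h = (cmod ?p)\<^sup>2 / ?h"
  proof -
    have "(cmod (- ?p / of_real x))\<^sup>2 * x = (cmod ?p)\<^sup>2 / x" if "0 < x" for x
      using that by (simp add: norm_divide power_divide) (simp add: power2_eq_square)
    then show ?thesis using assms(3) .
  qed
  finally have "(cmod ?p)\<^sup>2 / ?h \<le> (N f)\<^sup>2" by simp
  then show ?thesis using assms(3) by (simp add: field_simps)
qed

text \<open>By Pythagoras the squared norm of the remainder \<open>r n\<close> is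
  \<open>(N f)\<^sup>2\<close> minus the partial sum, and the definition of a basis lets this norm
  tend to 0.\<close>

lemma parseval:
  assumes e: "orthonormal_basis H N e" and f: "f \<in> H"
  shows "(\<lambda>n. (cmod (ip f (e n)))\<^sup>2) sums (N f)\<^sup>2"
proof -
  have eH: "e n \<in> H" for n using e by (simp add: orthonormal_basis_def)
  have orth: "ip (e m) (e n) = (if m = n then 1 else 0)" for m n
    using e inner_of_norm_eq[OF eH eH] by (simp add: orthonormal_basis_def)
  define r where "r n = (\<lambda>z. f z - (\<Sum>k<n. ip f (e k) * e k z))" for n
  have lim: "(\<lambda>n. N (r n)) \<longlonglongrightarrow> 0"
    using e f unfolding orthonormal_basis_def r_def by (simp add: inner_of_norm_eq eH)
  have r_Suc: "r (Suc n) = (\<lambda>z. r n z + (- ip f (e n)) * e n z)" for n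
    by (auto simp: r_def)
  have rH: "r n \<in> H" for n
  proof (induction n)
    case (Suc n)
    show ?case unfolding r_Suc by (intro add_mult_mem Suc eH)
  qed (simp add: r_def f)
  \<comment> \<open>The remainder has lost its components along the first n basis elements and kept
    the others; in particular \<open>ip (r n) (e n)\<close> is still \<open>ip f (e n)\<close>, as
    the recursion for the norms needs.\<close>
  have ip_r: "ip (r n) (e m) = ip f (e m) - (if m < n then ip f (e m) else 0)" for n m
  proof (induction n)
    case 0 then show ?case by (simp add: r_def)
  next
    case (Suc n)
    show ?case unfolding r_Suc ip_add_mult_left[OF rH eH eH] Suc orth
      by (auto simp: less_Suc_eq)
  qed
  have e1: "(N (e n))\<^sup>2 = 1" for n
  proof -
    have "(\<lambda>k. complex_of_real (w k * (cmod (coef (e n) k))\<^sup>2)) sums of_real ((N (e n))\<^sup>2)"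
      unfolding sums_of_real_iff by (rule norm_square(1)[OF eH])
    moreover have "(\<lambda>k. complex_of_real (w k * (cmod (coef (e n) k))\<^sup>2)) sums ip (e n) (e n)"
      using ip_sums[OF eH eH, of n n] by (simp only: of_real_mult complex_norm_square)
    ultimately have "of_real ((N (e n))\<^sup>2) = ip (e n) (e n)"
      by (rule sums_unique2)
    then show ?thesis using orth[of n n] by (metis of_real_eq_1_iff)
  qed
  have "(N (r n))\<^sup>2 = (N f)\<^sup>2 - (\<Sum>k<n. (cmod (ip f (e k)))\<^sup>2)" for n
  proof (induction n)
    case 0 then show ?case by (simp add: r_def)
  next
    case (Suc n)
    have "Re (cnj (- ip f (e n)) * ip f (e n)) = - (cmod (ip f (e n)))\<^sup>2"
      unfolding cmod_power2 by (simp add: power2_eq_square)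
    then show ?case
      unfolding r_Suc norm_add_mult[OF rH eH] ip_r e1 Suc by simp
  qed
  then have "(\<lambda>n. \<Sum>k<n. (cmod (ip f (e k)))\<^sup>2) = (\<lambda>n. (N f)\<^sup>2 - (N (r n))\<^sup>2)" by auto
  moreover have "(\<lambda>n. (N f)\<^sup>2 - (N (r n))\<^sup>2) \<longlonglongrightarrow> (N f)\<^sup>2 - 0\<^sup>2"
    by (intro tendsto_intros lim)
  ultimately show ?thesis by (simp add: sums_def)
qed

section \<open>Size of the kernel sums\<close>

definition kernel_sum :: "nat \<Rightarrow> real" where
  "kernel_sum m = (\<Sum>k. 1 / (w k * (real m + real k + 1)\<^sup>2))"

lemma kernel_term_le:
  "1 / (w k * (real m + real k + 1)\<^sup>2) \<le> (1 / A) * ((real k + 1) powr (- s) / (real m + real k + 1)\<^sup>2)"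
proof -
  have "1 / w k \<le> 1 / (A * (real k + 1) powr s)"
    by (intro divide_left_mono lower mult_pos_pos w_pos A) auto
  also have "\<dots> = (1 / A) * (real k + 1) powr (- s)" by (simp add: powr_minus_divide)
  finally have "1 / w k / (real m + real k + 1)\<^sup>2 \<le> (1 / A) * (real k + 1) powr (- s) / (real m + real k + 1)\<^sup>2"
    by (rule divide_right_mono) simp
  then show ?thesis by simp
qed

definition kernel_const :: real where
  "kernel_const = (1 / A) * (max 1 (1 / (1 - s)) + 1 / (1 + s))"

lemma kernel_partial_sum_le:
  "(\<Sum>k<K. 1 / (w k * (real m + real k + 1)\<^sup>2)) \<le> kernel_const * (real m + 1) powr (- 1 - s)"
proof -
  have "(\<Sum>k<K. 1 / (w k * (real m + real k + 1)\<^sup>2)) \<le> (\<Sum>k<K. (1 / A) * ((real k + 1) powr (- s) / (real m + real k + 1)\<^sup>2))"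
    by (intro sum_mono kernel_term_le)
  also have "\<dots> \<le> (1 / A) * ((max 1 (1 / (1 - s)) + 1 / (1 + s)) * (real m + 1) powr (- 1 - s))"
    unfolding sum_distrib_left[symmetric] using A by (intro mult_left_mono sum_powr_hilbert_kernel_le s) auto
  finally show ?thesis by (simp add: kernel_const_def mult.assoc)
qed

lemma kernel_term_nonneg: "0 \<le> 1 / (w k * (real m + real k + 1)\<^sup>2)"
  using w_nonneg[of k] by simp

lemma kernel_summable: "summable (\<lambda>k. 1 / (w k * (real m + real k + 1)\<^sup>2))"
  by (rule bounded_imp_summable[where B="kernel_const * (real m + 1) powr (- 1 - s)"])
     (use kernel_partial_sum_le[of m "Suc _"] kernel_term_nonneg in \<open>auto simp: lessThan_Suc_atMost\<close>)

lemma kernel_sum_pos: "0 < kernel_sum m"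
  unfolding kernel_sum_def
  by (rule suminf_pos[OF kernel_summable]) (auto intro!: divide_pos_pos mult_pos_pos w_pos)

lemma kernel_sum_le: "kernel_sum m \<le> kernel_const * (real m + 1) powr (- 1 - s)"
  unfolding kernel_sum_def by (rule suminf_le_const[OF kernel_summable kernel_partial_sum_le])

lemma B_pos: "0 < B"
  using upper[of 0] w_pos[of 0] by simp


text \<open>The m + 1 terms with m <= k <= 2 * m already have the right size: there w k <= B * 2
  powr |s| * (m + 1) powr s, and m + k + 1 <= 3 * (m + 1) accounts for the 9.\<close>

lemma kernel_sum_ge:
  "1 / (B * 2 powr \<bar>s\<bar> * 9) * (real m + 1) powr (- 1 - s) \<le> kernel_sum m"
proof -
  have term_ge: "1 / (B * 2 powr \<bar>s\<bar> * 9) * (real m + 1) powr (- 2 - s) \<le> 1 / (w k * (real m + real k + 1)\<^sup>2)"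
    if k: "k \<in> {m..2 * m}" for k
  proof -
    \<comment> \<open>Here k + 1 lies between m + 1 and 2 * (m + 1). For s >= 0 this costs 2 powr s;
      for s < 0 the power decreases and any factor of at least 1 will do.\<close>
    have "(real k + 1) powr s \<le> 2 powr \<bar>s\<bar> * (real m + 1) powr s"
    proof (cases "0 \<le> s")
      case True
      have "(real k + 1) powr s \<le> (2 * (real m + 1)) powr s"
        using k True by (intro powr_mono2) auto
      then show ?thesis using True by (simp only: powr_mult abs_of_nonneg)
    next
      case False
      have "(real k + 1) powr s \<le> 1 * (real m + 1) powr s"
        using k False by (simp, intro powr_mono2') auto
      also have "\<dots> \<le> 2 powr \<bar>s\<bar> * (real m + 1) powr s"
        by (intro mult_right_mono ge_one_powr_ge_zero) auto
      finally show ?thesis .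
    qed
    then have "w k \<le> B * (2 powr \<bar>s\<bar> * (real m + 1) powr s)"
      using upper[of k] B_pos by (meson mult_left_mono less_imp_le order_trans)
    moreover have "(real m + real k + 1)\<^sup>2 \<le> (3 * (real m + 1))\<^sup>2"
      using k by (intro power_mono) auto
    ultimately have "w k * (real m + real k + 1)\<^sup>2 \<le> B * (2 powr \<bar>s\<bar> * (real m + 1) powr s) * (3 * (real m + 1))\<^sup>2"
      using w_nonneg[of k] by (intro mult_mono) auto
    also have "\<dots> = (B * 2 powr \<bar>s\<bar> * 9) * ((real m + 1) powr s * (real m + 1) powr 2)"
      unfolding power_mult_distrib by simp
    also have "\<dots> = (B * 2 powr \<bar>s\<bar> * 9) * (real m + 1) powr (s + 2)"
      by (simp only: powr_add)
    finally have "1 / ((B * 2 powr \<bar>s\<bar> * 9) * (real m + 1) powr (s + 2)) \<le> 1 / (w k * (real m + real k + 1)\<^sup>2)"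
      using B_pos w_pos[of k] by (intro divide_left_mono mult_pos_pos) auto
    moreover have "- 2 - s = - (s + 2)" by simp
    then have "(real m + 1) powr (- 2 - s) = 1 / (real m + 1) powr (s + 2)"
      by (simp only: powr_minus_divide)
    ultimately show ?thesis by simp
  qed
  have "1 / (B * 2 powr \<bar>s\<bar> * 9) * (real m + 1) powr (- 1 - s) =
      (\<Sum>k\<in>{m..2 * m}. 1 / (B * 2 powr \<bar>s\<bar> * 9) * (real m + 1) powr (- 2 - s))"
  proof -
    \<comment> \<open>The interval has m + 1 elements, which raises the exponent by one.\<close>
    have "(real m + 1) powr (- 1 - s) = (real m + 1) powr 1 * (real m + 1) powr (- 2 - s)"
      using powr_add[of "real m + 1" 1 "- 2 - s"] by simp
    then show ?thesis by simp
  qed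
  also have "\<dots> \<le> (\<Sum>k\<in>{m..2 * m}. 1 / (w k * (real m + real k + 1)\<^sup>2))"
    by (rule sum_mono[OF term_ge])
  also have "\<dots> \<le> kernel_sum m"
    unfolding kernel_sum_def by (rule sum_le_suminf[OF kernel_summable]) (simp_all only: kernel_term_nonneg finite_atLeastAtMost)
  finally show ?thesis .
qed

text \<open>This makes \<open>moment_sums\<close> available on all of \<open>H\<close>. Each term is
  a product of sqrt (w k) * |coef f k| and 1 / (sqrt (w k) * (k + 1)), hence at most the sum of
  their squares; the latter square is the kernel term for m = 0.\<close>

lemma coef_kernel_summable:
  assumes "f \<in> H"
  shows "summable (\<lambda>k. cmod (coef f k) / (real k + 1))"
proof (rule summable_comparison_test'[of "\<lambda>k. w k * (cmod (coef f k))\<^sup>2 + 1 / (w k * (real 0 + real k + 1)\<^sup>2)" 0])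
  show "summable (\<lambda>k. w k * (cmod (coef f k))\<^sup>2 + 1 / (w k * (real 0 + real k + 1)\<^sup>2))"
    by (intro summable_add memD assms kernel_summable)
  fix k
  let ?x = "sqrt (w k) * cmod (coef f k)" and ?y = "1 / (sqrt (w k) * (real k + 1))"
  have "?x * ?y \<le> ?x\<^sup>2 + ?y\<^sup>2"
    using sum_squares_bound[of ?x ?y] mult_nonneg_nonneg[of ?x ?y] w_nonneg[of k]
    unfolding mult.assoc by simp
  then show "norm (cmod (coef f k) / (real k + 1)) \<le> w k * (cmod (coef f k))\<^sup>2 + 1 / (w k * (real 0 + real k + 1)\<^sup>2)"
    using w_pos[of k] by (simp add: power_mult_distrib power_divide)
qed

section \<open>Moments as inner products\<close>

text \<open>The Riesz representative of the m-th moment: the factor 1 / w k cancels the weight in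
  \<open>ip\<close> and leaves 1 / (m + k + 1), the integral of t ^ (m + k).\<close>

definition representer :: "nat \<Rightarrow> complex \<Rightarrow> complex" where
  "representer m z = (\<Sum>k. of_real (1 / (w k * (real m + real k + 1))) * z ^ k)"

lemma representer_sums:
  assumes "cmod z < 1"
  shows "(\<lambda>k. of_real (1 / (w k * (real m + real k + 1))) * z ^ k) sums representer m z"
proof -
  have "summable (\<lambda>k. of_real (1 / (w k * (real m + real k + 1))) * z ^ k)"
  proof (rule summable_comparison_test'[of "\<lambda>k. 1 / A * cmod z ^ k" 0])
    show "summable (\<lambda>k. 1 / A * cmod z ^ k)"
      using assms by (intro summable_mult summable_geometric) simp
    fix k
    \<comment> \<open>Since s > -1, the power (k + 1) powr (s + 1) is at least 1, so the
      coefficients are bounded by 1 / A and a geometric series dominates.\<close>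
    have "A * 1 \<le> A * ((real k + 1) powr s * (real k + 1) powr 1)"
      unfolding powr_add[symmetric] using A s by (intro mult_left_mono ge_one_powr_ge_zero) auto
    also have "\<dots> = A * (real k + 1) powr s * (real k + 1)" by simp
    also have "\<dots> \<le> w k * (real m + real k + 1)"
      using w_nonneg[of k] by (intro mult_mono lower) auto
    finally have "1 / (w k * (real m + real k + 1)) \<le> 1 / A"
      using A w_pos[of k] by (intro divide_left_mono mult_pos_pos) auto
    then have "1 / (w k * (real m + real k + 1)) * cmod z ^ k \<le> 1 / A * cmod z ^ k"
      by (rule mult_right_mono) simp
    then show "norm (of_real (1 / (w k * (real m + real k + 1))) * z ^ k) \<le> 1 / A * cmod z ^ k"
      unfolding norm_mult norm_power norm_of_real using w_nonneg[of k] by simp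
  qed
  then show ?thesis unfolding representer_def by (rule summable_sums)
qed

lemma coef_representer: "coef (representer m) k = of_real (1 / (w k * (real m + real k + 1)))"
  by (rule coef_eqI(2)[OF representer_sums])

lemma representer_weight_term:
  "w k * (cmod (coef (representer m) k))\<^sup>2 = 1 / (w k * (real m + real k + 1)\<^sup>2)"
  unfolding coef_representer norm_of_real using w_pos[of k]
  by (simp add: power_divide power_mult_distrib) (simp add: power2_eq_square)

lemma representer_mem: "representer m \<in> H"
  unfolding mem_iff representer_weight_term
  using coef_eqI(1)[OF representer_sums] kernel_summable by blast

lemma representer_norm: "(N (representer m))\<^sup>2 = kernel_sum m"
  using norm_square(1)[OF representer_mem, of m] unfolding representer_weight_term kernel_sum_def
  by (simp add: sums_iff)

lemma ip_representer:
  assumes "f \<in> H"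
  shows "ip f (representer m) = moment f m"
proof -
  have "of_real (w k) * (coef f k * cnj (coef (representer m) k)) = coef f k / of_nat (m + k + 1)" for k
    unfolding coef_representer using w_pos[of k] by (simp add: add_ac)
  with ip_sums[OF assms representer_mem, of m] moment_sums(2)[OF memD(1)[OF assms] coef_kernel_summable[OF assms], of m]
  show ?thesis by (simp add: sums_iff)
qed

lemma moment_le:
  assumes "f \<in> H"
  shows "(cmod (moment f m))\<^sup>2 \<le> (N f)\<^sup>2 * kernel_sum m"
  using cauchy_schwarz[OF assms representer_mem, of m] kernel_sum_pos[of m]
  by (simp add: ip_representer[OF assms] representer_norm)

lemma moment_parseval:
  assumes "orthonormal_basis H N e"
  shows "(\<lambda>n. (cmod (moment (e n) m))\<^sup>2) sums kernel_sum m"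
proof -
  have eH: "e n \<in> H" for n using assms by (simp add: orthonormal_basis_def)
  have "cmod (ip (representer m) (e n)) = cmod (moment (e n) m)" for n
    using ip_commute[OF eH representer_mem, of m n] by (simp add: ip_representer[OF eH])
  with parseval[OF assms representer_mem, of m] show ?thesis by (simp add: representer_norm)
qed

text \<open>Dividing by sqrt (w k) makes these orthonormal; they are the basis exhibited when the
  Hilbert--Schmidt property is to be established.\<close>

definition monomial :: "nat \<Rightarrow> complex \<Rightarrow> complex" where
  "monomial k z = of_real (1 / sqrt (w k)) * z ^ k"

lemma monomial_sums:
  "(\<lambda>n. (if n = k then of_real (1 / sqrt (w k)) else 0) * z ^ n) sums monomial k z"
  using sums_single[of k "\<lambda>n. of_real (1 / sqrt (w k)) * z ^ n"]
  by (simp add: monomial_def if_distrib[of "\<lambda>x. x * _"] cong: if_cong)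

lemma coef_monomial: "coef (monomial k) n = (if n = k then of_real (1 / sqrt (w k)) else 0)"
  by (rule coef_eqI(2)[OF monomial_sums])

lemma monomial_mem: "monomial k \<in> H"
  unfolding mem_iff
proof
  show "monomial k holomorphic_on unit_disc"
    by (rule coef_eqI(1)[OF monomial_sums])
  show "summable (\<lambda>n. w n * (cmod (coef (monomial k) n))\<^sup>2)"
    by (rule summable_finite[of "{k}"]) (auto simp: coef_monomial)
qed

lemma ip_monomial:
  assumes "f \<in> H"
  shows "ip f (monomial k) = of_real (sqrt (w k)) * coef f k"
proof -
  have "(\<lambda>n. of_real (w n) * (coef f n * cnj (coef (monomial k) n)))
      = (\<lambda>n. if n = k then of_real (w n) * (coef f n * of_real (1 / sqrt (w k))) else 0)"
    by (auto simp: coef_monomial)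
  then have "ip f (monomial k) = of_real (w k) * (coef f k * of_real (1 / sqrt (w k)))"
    using ip_sums[OF assms monomial_mem, of k]
      sums_single[of k "\<lambda>n. of_real (w n) * (coef f n * of_real (1 / sqrt (w k)))"]
    by (simp add: sums_unique2)
  also have "\<dots> = of_real (w k / sqrt (w k)) * coef f k" by simp
  also have "w k / sqrt (w k) = sqrt (w k)" using w_nonneg[of k] by (rule real_div_sqrt)
  finally show ?thesis .
qed

lemma orthonormal_basis_monomial: "orthonormal_basis H N monomial"
  unfolding orthonormal_basis_def
proof (intro conjI allI ballI)
  show "monomial n \<in> H" for n by (rule monomial_mem)
  show "inner_of_norm N (monomial m) (monomial n) = (if m = n then 1 else 0)" for m n
    unfolding inner_of_norm_eq[OF monomial_mem monomial_mem] ip_monomial[OF monomial_mem]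
    using w_pos[of n] by (simp add: coef_monomial flip: of_real_mult)
  fix f assume f: "f \<in> H"
  \<comment> \<open>Subtracting n terms of the expansion deletes the first n Taylor coefficients, so
    the squared norm of \<open>r n\<close> is the tail of a convergent series.\<close>
  define r where "r n = (\<lambda>z. f z - (\<Sum>k<n. inner_of_norm N f (monomial k) * monomial k z))" for n
  have r: "r n \<in> H \<and> (\<forall>j. coef (r n) j = (if j < n then 0 else coef f j))" for n
  proof (induction n)
    case 0 then show ?case using f by (simp add: r_def)
  next
    case (Suc n)
    have Suc_eq: "r (Suc n) = (\<lambda>z. r n z + (- ip f (monomial n)) * monomial n z)"
      by (auto simp: r_def inner_of_norm_eq f monomial_mem)
    have "coef (r (Suc n)) j = (if j < Suc n then 0 else coef f j)" for j
      unfolding Suc_eq coef_add_mult[OF conjunct1[OF Suc] monomial_mem] ip_monomial[OF f]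
      using Suc w_pos[of n] by (auto simp: coef_monomial less_Suc_eq simp flip: of_real_mult of_real_divide)
    moreover have "r (Suc n) \<in> H"
      unfolding Suc_eq using Suc by (intro add_mult_mem monomial_mem) auto
    ultimately show ?case by auto
  qed
  let ?x = "\<lambda>j. w j * (cmod (coef f j))\<^sup>2"
  have "N (r n) = sqrt ((N f)\<^sup>2 - (\<Sum>j<n. ?x j))" for n
  proof -
    have rn: "r n \<in> H" and eq: "(\<lambda>j. w j * (cmod (coef (r n) j))\<^sup>2) = (\<lambda>j. ?x j - (if j < n then ?x j else 0))"
      using r[of n] by auto
    have "(\<lambda>j. ?x j - (if j < n then ?x j else 0)) sums ((N f)\<^sup>2 - (\<Sum>j<n. ?x j))"
      using sums_If_finite_set[of "{..<n}" ?x] by (intro sums_diff norm_square(1)[OF f]) simp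
    from sums_unique2[OF norm_square(1)[OF rn, unfolded eq] this]
    show ?thesis using norm_square(2)[OF rn] by (simp add: real_sqrt_unique)
  qed
  moreover have "(\<lambda>n. sqrt ((N f)\<^sup>2 - (\<Sum>j<n. ?x j))) \<longlonglongrightarrow> sqrt ((N f)\<^sup>2 - (N f)\<^sup>2)"
    using norm_square(1)[OF f] unfolding sums_def by (intro tendsto_intros)
  ultimately show "(\<lambda>n. N (\<lambda>z. f z - (\<Sum>k<n. inner_of_norm N f (monomial k) * monomial k z))) \<longlonglongrightarrow> 0"
    unfolding r_def by simp
qed

section \<open>The operator on a weighted space\<close>

lemma generalized_hilbert_mem_iff:
  assumes g: "g holomorphic_on unit_disc" and f: "f \<in> H"
  shows "generalized_hilbert g f \<in> H \<longleftrightarrow>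
    summable (\<lambda>m. w m * (cmod (coef (deriv g) m))\<^sup>2 * (cmod (moment f m))\<^sup>2)"
  unfolding mem_iff
  using generalized_hilbert_coef[OF memD(1)[OF f] coef_kernel_summable[OF f] g]
  by (simp add: norm_mult power_mult_distrib mult.assoc)

lemma generalized_hilbert_norm:
  assumes g: "g holomorphic_on unit_disc" and f: "f \<in> H" and "generalized_hilbert g f \<in> H"
  shows "(\<lambda>m. w m * (cmod (coef (deriv g) m))\<^sup>2 * (cmod (moment f m))\<^sup>2) sums (N (generalized_hilbert g f))\<^sup>2"
  using norm_square(1)[OF assms(3)] generalized_hilbert_coef(2)[OF memD(1)[OF f] coef_kernel_summable[OF f] g]
  by (simp add: norm_mult power_mult_distrib mult.assoc)

text \<open>Linearity in \<open>bounded_operator_on\<close> is an equation between norms; outside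
  the disc the functions may differ.\<close>

lemma norm_eq_0:
  assumes "\<And>z. cmod z < 1 \<Longrightarrow> f z = 0"
  shows "N f = 0"
proof -
  have s: "(\<lambda>n. 0 * z ^ n) sums f z" if "cmod z < 1" for z
    using assms[OF that] by simp
  have c: "f holomorphic_on unit_disc" "coef f n = 0" for n
    using coef_eqI[of "\<lambda>_. 0" f] s by auto
  then have "f \<in> H" by (simp add: mem_iff)
  from norm_eq[OF this] show ?thesis by (simp add: c)
qed

text \<open>Comparing power series reduces linearity to that of the moments, which is visible in
  their series.\<close>

lemma generalized_hilbert_linear:
  assumes g: "g holomorphic_on unit_disc" and "f \<in> H" "h \<in> H" and z: "cmod z < 1"
  shows "generalized_hilbert g (\<lambda>w. a * f w + b * h w) z = a * generalized_hilbert g f z + b * generalized_hilbert g h z"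
proof -
  have Tsums: "(\<lambda>m. coef (deriv g) m * moment k m * z ^ m) sums generalized_hilbert g k z" if "k \<in> H" for k
    using coef_sums[OF generalized_hilbert_coef(1)[OF memD(1)[OF that] coef_kernel_summable[OF that] g] z]
      generalized_hilbert_coef(2)[OF memD(1)[OF that] coef_kernel_summable[OF that] g] by simp
  have msums: "(\<lambda>j. coef k j / of_nat (m + j + 1)) sums moment k m" if "k \<in> H" for k m
    by (rule moment_sums(2)[OF memD(1)[OF that] coef_kernel_summable[OF that]])
  have k: "(\<lambda>w. a * f w + b * h w) \<in> H" by (intro lincomb_mem assms)
  have "moment (\<lambda>w. a * f w + b * h w) m = a * moment f m + b * moment h m" for m
  proof (rule sums_unique2[OF msums[OF k]])
    have "(\<lambda>j. a * (coef f j / of_nat (m + j + 1)) + b * (coef h j / of_nat (m + j + 1))) sums (a * moment f m + b * moment h m)"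
      by (intro sums_add sums_mult msums assms)
    then show "(\<lambda>j. coef (\<lambda>w. a * f w + b * h w) j / of_nat (m + j + 1)) sums (a * moment f m + b * moment h m)"
      unfolding coef_lincomb[OF memD(1)[OF assms(2)] memD(1)[OF assms(3)]]
      by (simp add: add_divide_distrib)
  qed
  then have "(\<lambda>m. coef (deriv g) m * (a * moment f m + b * moment h m) * z ^ m) sums generalized_hilbert g (\<lambda>w. a * f w + b * h w) z"
    using Tsums[OF k] by simp
  moreover have "(\<lambda>m. a * (coef (deriv g) m * moment f m * z ^ m) + b * (coef (deriv g) m * moment h m * z ^ m)) sums (a * generalized_hilbert g f z + b * generalized_hilbert g h z)"
    by (intro sums_add sums_mult Tsums assms)
  ultimately show ?thesis
    by (intro sums_unique2[of _ "generalized_hilbert g (\<lambda>w. a * f w + b * h w) z"]) (auto simp: algebra_simps)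
qed

text \<open>Both sides are iterated sums of the nonnegative terms D m * |moment (e n) m|^2: summing
  over m gives the squared norm of \<open>T (e n)\<close>, summing over n gives D m * kernel_sum
  m.\<close>

lemma hilbert_schmidt_iff_kernel_sum:
  assumes g: "g holomorphic_on unit_disc"
  shows "hilbert_schmidt_on H N (generalized_hilbert g) \<longleftrightarrow>
    summable (\<lambda>m. w m * (cmod (coef (deriv g) m))\<^sup>2 * kernel_sum m)"
proof -
  define T where "T = generalized_hilbert g"
  define D where "D m = w m * (cmod (coef (deriv g) m))\<^sup>2" for m
  have D0: "0 \<le> D m" for m using w_nonneg by (simp add: D_def)
  have K0: "0 \<le> kernel_sum m" for m using kernel_sum_pos less_imp_le by blast
  have Tnorm: "(\<lambda>m. D m * (cmod (moment f m))\<^sup>2) sums (N (T f))\<^sup>2" if "f \<in> H" "T f \<in> H" for f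
    using generalized_hilbert_norm[OF g that[unfolded T_def]] by (simp add: D_def T_def)
  have "hilbert_schmidt_on H N T \<longleftrightarrow> summable (\<lambda>m. D m * kernel_sum m)"
  proof
    assume "hilbert_schmidt_on H N T"
    then obtain e where TH: "\<And>f. f \<in> H \<Longrightarrow> T f \<in> H"
      and e: "orthonormal_basis H N e" and sum: "summable (\<lambda>n. (N (T (e n)))\<^sup>2)"
      by (auto simp: hilbert_schmidt_on_def bounded_operator_on_def)
    have eH: "e n \<in> H" for n using e by (simp add: orthonormal_basis_def)
    \<comment> \<open>The cut-off in m allows the sum over n to be taken termwise, for whatever
      basis \<open>e\<close> is given.\<close>
    have "(\<Sum>m<M. D m * kernel_sum m) \<le> (\<Sum>n. (N (T (e n)))\<^sup>2)" for M
    proof -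
      have "(\<lambda>n. \<Sum>m<M. D m * (cmod (moment (e n) m))\<^sup>2) sums (\<Sum>m<M. D m * kernel_sum m)"
        by (intro sums_sum sums_mult moment_parseval e)
      then show ?thesis
      proof (rule sums_le[rotated, OF _ summable_sums[OF sum]])
        fix n
        note p = Tnorm[OF eH TH[OF eH], of n]
        have "(\<Sum>m<M. D m * (cmod (moment (e n) m))\<^sup>2) \<le> (\<Sum>m. D m * (cmod (moment (e n) m))\<^sup>2)"
          using p D0 by (intro sum_le_suminf) (auto simp: sums_iff)
        then show "(\<Sum>m<M. D m * (cmod (moment (e n) m))\<^sup>2) \<le> (N (T (e n)))\<^sup>2"
          using p by (simp add: sums_iff)
      qed
    qed
    from this[of "Suc _"] show "summable (\<lambda>m. D m * kernel_sum m)"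
      unfolding lessThan_Suc_atMost by (rule bounded_imp_summable[rotated]) (simp add: D0 K0)
  next
    assume sum: "summable (\<lambda>m. D m * kernel_sum m)"
    \<comment> \<open>Cauchy-Schwarz for the moments; this yields membership of \<open>T f\<close>
      as well as the operator bound.\<close>
    have bound: "D m * (cmod (moment f m))\<^sup>2 \<le> D m * kernel_sum m * (N f)\<^sup>2" if "f \<in> H" for f m
      using mult_left_mono[OF moment_le[OF that, of m] D0[of m]] by (simp add: mult_ac)
    have TH: "T f \<in> H" if "f \<in> H" for f
      unfolding T_def generalized_hilbert_mem_iff[OF g that] D_def[symmetric]
      by (rule summable_comparison_test'[of "\<lambda>m. D m * kernel_sum m * (N f)\<^sup>2" 0])
         (use bound[OF that] D0 in \<open>auto intro!: summable_mult2 sum\<close>)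
    have Tbound: "N (T f) \<le> sqrt (\<Sum>m. D m * kernel_sum m) * N f" if "f \<in> H" for f
    proof -
      have "(N (T f))\<^sup>2 \<le> (\<Sum>m. D m * kernel_sum m) * (N f)\<^sup>2"
        by (rule sums_le[OF bound[OF that] Tnorm[OF that TH[OF that]] sums_mult2[OF summable_sums[OF sum]]])
      then have "N (T f) \<le> sqrt ((\<Sum>m. D m * kernel_sum m) * (N f)\<^sup>2)"
        by (rule real_le_rsqrt)
      then show ?thesis using norm_square(2)[OF that] by (simp add: real_sqrt_mult)
    qed
    have "bounded_operator_on H N T"
      unfolding bounded_operator_on_def
    proof (intro conjI ballI allI)
      fix f h a b assume "f \<in> H" "h \<in> H"
      then show "N (\<lambda>z. T (\<lambda>w. a * f w + b * h w) z - (a * T f z + b * T h z)) = 0"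
        unfolding T_def by (intro norm_eq_0) (simp add: generalized_hilbert_linear[OF g])
    qed (use TH Tbound in auto)
    moreover have "summable (\<lambda>n. (N (T (monomial n)))\<^sup>2)"
    proof (rule bounded_imp_summable[where B="\<Sum>m. D m * kernel_sum m"])
      fix n
      \<comment> \<open>Now the cut-off is in the basis index, and the sum over m is taken
        first.\<close>
      have "(\<lambda>m. \<Sum>k\<le>n. D m * (cmod (moment (monomial k) m))\<^sup>2) sums (\<Sum>k\<le>n. (N (T (monomial k)))\<^sup>2)"
        by (intro sums_sum Tnorm TH monomial_mem)
      then show "(\<Sum>k\<le>n. (N (T (monomial k)))\<^sup>2) \<le> (\<Sum>m. D m * kernel_sum m)"
      proof (rule sums_le[rotated, OF _ summable_sums[OF sum]])
        fix m
        note p = moment_parseval[OF orthonormal_basis_monomial, of m]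
        have "(\<Sum>k\<le>n. (cmod (moment (monomial k) m))\<^sup>2) \<le> (\<Sum>k. (cmod (moment (monomial k) m))\<^sup>2)"
          using p by (intro sum_le_suminf) (auto simp: sums_iff)
        also have "\<dots> = kernel_sum m" using p by (simp add: sums_iff)
        finally show "(\<Sum>k\<le>n. D m * (cmod (moment (monomial k) m))\<^sup>2) \<le> D m * kernel_sum m"
          using D0[of m] by (simp add: mult_left_mono flip: sum_distrib_left)
      qed
    qed simp
    ultimately show "hilbert_schmidt_on H N T"
      using orthonormal_basis_monomial by (auto simp: hilbert_schmidt_on_def)
  qed
  then show ?thesis unfolding T_def D_def .
qed

theorem hilbert_schmidt_iff:
  assumes g: "g holomorphic_on unit_disc"
  shows "hilbert_schmidt_on H N (generalized_hilbert g) \<longleftrightarrow>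
    summable (\<lambda>m. (cmod (coef (deriv g) m))\<^sup>2 / (real m + 1))"
proof -
  let ?c = "\<lambda>m. (cmod (coef (deriv g) m))\<^sup>2"
  define c1 where "c1 = A * (1 / (B * 2 powr \<bar>s\<bar> * 9))"
  define c2 where "c2 = B * kernel_const"
  have c1: "0 < c1" unfolding c1_def using A B_pos by simp
  \<comment> \<open>The exponents of the two factors add up to -1, which is where \<open>s\<close>
    disappears.\<close>
  have pow: "(real m + 1) powr s * (real m + 1) powr (- 1 - s) = 1 / (real m + 1)" for m
    by (subst powr_add[symmetric]) (simp add: powr_minus_divide)
  have lo: "c1 / (real m + 1) \<le> w m * kernel_sum m" for m
  proof -
    have "(A * (real m + 1) powr s) * (1 / (B * 2 powr \<bar>s\<bar> * 9) * (real m + 1) powr (- 1 - s)) \<le> w m * kernel_sum m"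
      by (intro mult_mono lower kernel_sum_ge w_nonneg) (use B_pos in auto)
    then show ?thesis using pow[of m] by (simp add: c1_def mult_ac)
  qed
  have up: "w m * kernel_sum m \<le> c2 / (real m + 1)" for m
  proof -
    have "w m * kernel_sum m \<le> (B * (real m + 1) powr s) * (kernel_const * (real m + 1) powr (- 1 - s))"
      using kernel_sum_pos[of m] B_pos by (intro mult_mono upper kernel_sum_le) auto
    then show ?thesis using pow[of m] by (simp add: c2_def mult_ac)
  qed
  have "summable (\<lambda>m. w m * ?c m * kernel_sum m) \<longleftrightarrow> summable (\<lambda>m. ?c m / (real m + 1))"
  proof
    assume s: "summable (\<lambda>m. w m * ?c m * kernel_sum m)"
    have "summable (\<lambda>m. c1 * (?c m / (real m + 1)))"
    proof (rule summable_comparison_test'[OF s, of 0])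
      fix m
      show "norm (c1 * (?c m / (real m + 1))) \<le> w m * ?c m * kernel_sum m"
        using mult_left_mono[OF lo[of m], of "?c m"] c1 by (simp add: mult_ac)
    qed
    then show "summable (\<lambda>m. ?c m / (real m + 1))"
      using c1 by (subst (asm) summable_cmult_iff) auto
  next
    assume "summable (\<lambda>m. ?c m / (real m + 1))"
    from summable_mult[OF this, of c2]
    show "summable (\<lambda>m. w m * ?c m * kernel_sum m)"
    proof (rule summable_comparison_test'[of _ 0])
      fix m
      show "norm (w m * ?c m * kernel_sum m) \<le> c2 * (?c m / (real m + 1))"
        using mult_left_mono[OF up[of m], of "?c m"] w_nonneg[of m] kernel_sum_pos[of m]
        by (simp add: mult_ac)
    qed
  qed
  then show ?thesis by (simp add: hilbert_schmidt_iff_kernel_sum[OF g])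
qed

end

subsection \<open>Weights of the concrete spaces\<close>

text \<open>The product form matches \<open>Gamma_series\<close> and, for a = 0, collapses to 1 / (n
  + 1).\<close>

lemma Beta_eq_fact_pochhammer:
  fixes a :: real
  assumes "a > -1"
  shows "Beta (real n + 1) (a + 1) = fact n / pochhammer (a + 1) (n + 1)"
proof -
  have nz: "a + 1 \<notin> \<int>\<^sub>\<le>\<^sub>0" using assms by (auto elim!: nonpos_Ints_cases)
  have "Gamma (real n + 1) = fact n"
    using Gamma_fact[of n, where 'a=real] by (simp add: add.commute)
  moreover have "Gamma (a + 1) > 0" using assms by (intro Gamma_real_pos) simp
  moreover have "Gamma (real n + 1 + (a + 1)) = Gamma (a + 1) * pochhammer (a + 1) (n + 1)"
    using pochhammer_Gamma[OF nz, of "n + 1"] \<open>Gamma (a + 1) > 0\<close> by (simp add: add_ac)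
  ultimately show ?thesis unfolding Beta_def by simp
qed

text \<open>Up to a factor tending to 1, the Beta value times (n + 1) powr (a + 1) is Euler's
  product for Gamma (a + 1).\<close>

lemma bergman_weight_LIMSEQ:
  assumes "a > -1"
  shows "(\<lambda>n. bergman_weight a n * (real n + 1) powr (a + 1)) \<longlonglongrightarrow> (a + 1) * Gamma (a + 1)"
proof -
  have "(\<lambda>n. ((real n + 1) / real n) powr (a + 1)) \<longlonglongrightarrow> 1 powr (a + 1)"
    by (rule tendsto_powr) (real_asymp | simp)+
  then have "(\<lambda>n. (a + 1) * (Gamma_series (a + 1) n * ((real n + 1) / real n) powr (a + 1))) \<longlonglongrightarrow> (a + 1) * (Gamma (a + 1) * 1)"
    by (intro tendsto_intros Gamma_series_LIMSEQ) simp
  moreover have "\<forall>\<^sub>F n in sequentially. (a + 1) * (Gamma_series (a + 1) n * ((real n + 1) / real n) powr (a + 1)) =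
      bergman_weight a n * (real n + 1) powr (a + 1)"
    using eventually_gt_at_top[of 0]
  proof eventually_elim
    case (elim n)
    then show ?case
      unfolding bergman_weight_def Beta_eq_fact_pochhammer[OF assms] Gamma_series_def
      by (simp add: powr_divide) (simp add: powr_def)
  qed
  ultimately show ?thesis
    by (simp add: tendsto_cong)
qed

text \<open>The sequence \<open>x\<close> is positive with a nonzero limit, so \<open>x\<close> and
  its inverse are both bounded, by \<open>B\<close> and \<open>K\<close>; the lower constant is then
  1 / K.\<close>

lemma bergman_weight_bounds:
  assumes "a > -1"
  obtains A B where "0 < A" "\<And>n. A * (real n + 1) powr (- 1 - a) \<le> bergman_weight a n"
    "\<And>n. bergman_weight a n \<le> B * (real n + 1) powr (- 1 - a)"
proof -
  define x where "x n = bergman_weight a n * (real n + 1) powr (a + 1)" for n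
  have x: "x \<longlonglongrightarrow> (a + 1) * Gamma (a + 1)"
    using bergman_weight_LIMSEQ[OF assms] by (simp add: x_def[abs_def])
  have xpos: "0 < x n" for n unfolding x_def using bergman_weight_pos[OF assms] by simp
  have "0 < (a + 1) * Gamma (a + 1)"
    using assms by (intro mult_pos_pos Gamma_real_pos) auto
  then have L: "(a + 1) * Gamma (a + 1) \<noteq> 0" by (metis less_irrefl)
  have "Bseq x" "Bseq (\<lambda>n. inverse (x n))"
    using x tendsto_inverse[OF x L] by (auto intro!: convergent_imp_Bseq convergentI)
  then obtain B K where B: "\<And>n. norm (x n) \<le> B" and K: "0 < K" "\<And>n. norm (inverse (x n)) \<le> K"
    by (auto simp: Bseq_def)
  have w: "bergman_weight a n = x n * (real n + 1) powr (- 1 - a)" for n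
  proof -
    have "(real n + 1) powr (a + 1) * (real n + 1) powr (- 1 - a) = 1"
      by (subst powr_add[symmetric]) simp
    then show ?thesis by (simp add: x_def mult.assoc)
  qed
  show thesis
  proof (rule that[of "1 / K" B])
    show "0 < 1 / K" using K by simp
    fix n
    have "1 / K \<le> x n" using K(1) K(2)[of n] xpos[of n] by (simp add: field_simps)
    then show "1 / K * (real n + 1) powr (- 1 - a) \<le> bergman_weight a n"
      unfolding w by (rule mult_right_mono) simp
    have "x n \<le> B" using B[of n] by simp
    then show "bergman_weight a n \<le> B * (real n + 1) powr (- 1 - a)"
      unfolding w by (rule mult_right_mono) simp
  qed
qed

lemma hardy_hilbert_schmidt_iff:
  assumes "g holomorphic_on unit_disc"
  shows "hilbert_schmidt_on hardy_space hardy_norm (generalized_hilbert g) \<longleftrightarrow>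
    summable (\<lambda>m. (cmod (coef (deriv g) m))\<^sup>2 / (real m + 1))"
proof -
  interpret weighted_taylor_space hardy_space hardy_norm "\<lambda>_. 1" 0 1 1
    by standard (auto simp: hardy_space_iff hardy_norm_eq)
  show ?thesis by (rule hilbert_schmidt_iff[OF assms])
qed

text \<open>The bound a < 0 puts the exponent -1 - a above -1.\<close>

lemma bergman_hilbert_schmidt_iff:
  assumes "g holomorphic_on unit_disc" and a: "-1 < a" "a < 0"
  shows "hilbert_schmidt_on (bergman_space a) (bergman_norm a) (generalized_hilbert g) \<longleftrightarrow>
    summable (\<lambda>m. (cmod (coef (deriv g) m))\<^sup>2 / (real m + 1))"
proof -
  obtain A B where AB: "0 < A" "\<And>n. A * (real n + 1) powr (- 1 - a) \<le> bergman_weight a n"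
    "\<And>n. bergman_weight a n \<le> B * (real n + 1) powr (- 1 - a)"
    using bergman_weight_bounds[OF a(1)] by auto
  have hol: "f holomorphic_on unit_disc" if "f \<in> bergman_space a" for f
    using that by (simp add: bergman_space_def)
  interpret weighted_taylor_space "bergman_space a" "bergman_norm a" "bergman_weight a" "- 1 - a" A B
  proof
    fix f :: "complex \<Rightarrow> complex"
    show "f \<in> bergman_space a \<longleftrightarrow> f holomorphic_on unit_disc \<and> summable (\<lambda>n. bergman_weight a n * (cmod (coef f n))\<^sup>2)"
      using bergman_space_norm(1)[OF _ a(1)] hol by blast
    show "bergman_norm a f = sqrt (\<Sum>n. bergman_weight a n * (cmod (coef f n))\<^sup>2)" if "f \<in> bergman_space a"
      by (rule bergman_space_norm(2)[OF hol[OF that] a(1) that])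
  qed (use AB a in auto)
  show ?thesis by (rule hilbert_schmidt_iff[OF assms(1)])
qed

section \<open>Dirichlet spaces and conclusion\<close>

text \<open>Differentiation moves coefficient Suc k to index k and multiplies it by Suc k; index 0
  carries |f 0|^2 with weight 1.\<close>

definition dirichlet_weight :: "real \<Rightarrow> nat \<Rightarrow> real" where
  "dirichlet_weight a n = (case n of 0 \<Rightarrow> 1 | Suc k \<Rightarrow> (real (Suc k))\<^sup>2 * bergman_weight a k)"

lemma dirichlet_weight_bounds:
  assumes a: "0 < a" "a \<le> 1"
  obtains A B where "0 < A" "\<And>n. A * (real n + 1) powr (1 - a) \<le> dirichlet_weight a n"
    "\<And>n. dirichlet_weight a n \<le> B * (real n + 1) powr (1 - a)"
proof -
  obtain A B where A: "0 < A" and lo: "\<And>n. A * (real n + 1) powr (- 1 - a) \<le> bergman_weight a n"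
    and up: "\<And>n. bergman_weight a n \<le> B * (real n + 1) powr (- 1 - a)"
    using bergman_weight_bounds[of a] a by auto
  have B: "0 \<le> B"
    using up[of 0] bergman_weight_pos[of a 0] a by simp
  have pow: "(real (Suc k))\<^sup>2 * (real k + 1) powr (- 1 - a) = (real k + 1) powr (1 - a)" for k
  proof -
    have "(real k + 1) powr (1 - a) = (real k + 1) powr 2 * (real k + 1) powr (- 1 - a)"
      by (subst powr_add[symmetric]) simp
    then show ?thesis by (simp add: add.commute)
  qed
  show thesis
  \<comment> \<open>The 1 in both constants serves index 0. For n = Suc k the half makes up for 2
    powr (1 - a) <= 2, which comes from n + 1 <= 2 * (k + 1).\<close>
  proof (rule that[of "min 1 (A / 2)" "max 1 B"])
    show "0 < min 1 (A / 2)" using A by simp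
    fix n
    show "min 1 (A / 2) * (real n + 1) powr (1 - a) \<le> dirichlet_weight a n"
    proof (cases n)
      case (Suc k)
      have "(real n + 1) powr (1 - a) \<le> (2 * (real k + 1)) powr (1 - a)"
        using Suc a by (intro powr_mono2) auto
      also have "\<dots> = 2 powr (1 - a) * (real k + 1) powr (1 - a)"
        by (rule powr_mult)
      also have "\<dots> \<le> 2 powr 1 * (real k + 1) powr (1 - a)"
        using a by (intro mult_right_mono powr_mono) auto
      finally have "min 1 (A / 2) * (real n + 1) powr (1 - a) \<le> A / 2 * (2 powr 1 * (real k + 1) powr (1 - a))"
        using A by (intro mult_mono) auto
      also have "\<dots> = (real (Suc k))\<^sup>2 * (A * (real k + 1) powr (- 1 - a))"
        unfolding pow[symmetric] by simp
      also have "\<dots> \<le> (real (Suc k))\<^sup>2 * bergman_weight a k"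
        by (intro mult_left_mono lo) simp
      finally show ?thesis by (simp add: dirichlet_weight_def Suc)
    qed (simp add: dirichlet_weight_def)
    show "dirichlet_weight a n \<le> max 1 B * (real n + 1) powr (1 - a)"
    proof (cases n)
      case (Suc k)
      have "(real (Suc k))\<^sup>2 * bergman_weight a k \<le> (real (Suc k))\<^sup>2 * (B * (real k + 1) powr (- 1 - a))"
        by (intro mult_left_mono up) simp
      also have "\<dots> = B * (real k + 1) powr (1 - a)"
        unfolding pow[symmetric] by simp
      also have "\<dots> \<le> max 1 B * (real n + 1) powr (1 - a)"
        using Suc a B by (intro mult_mono powr_mono2) auto
      finally show ?thesis by (simp add: dirichlet_weight_def Suc)
    qed (simp add: dirichlet_weight_def)
  qed
qed

lemma coef_0: "coef f 0 = f 0"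
  by (simp add: fps_expansion_def)

lemma dirichlet_space_norm:
  assumes f: "f holomorphic_on unit_disc" and a: "a > -1"
  shows "f \<in> dirichlet_space a \<longleftrightarrow> summable (\<lambda>n. dirichlet_weight a n * (cmod (coef f n))\<^sup>2)" (is ?A)
    and "f \<in> dirichlet_space a \<Longrightarrow> dirichlet_norm a f = sqrt (\<Sum>n. dirichlet_weight a n * (cmod (coef f n))\<^sup>2)" (is "_ \<Longrightarrow> ?B")
proof -
  have f': "deriv f holomorphic_on unit_disc"
    using f by (intro holomorphic_deriv) auto
  have shift: "bergman_weight a n * (cmod (coef (deriv f) n))\<^sup>2 = dirichlet_weight a (Suc n) * (cmod (coef f (Suc n)))\<^sup>2" for n
    by (simp add: coef_deriv dirichlet_weight_def norm_mult power_mult_distrib del: of_nat_Suc)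
  have "f \<in> dirichlet_space a \<longleftrightarrow> deriv f \<in> bergman_space a"
    using f by (simp add: dirichlet_space_def)
  also have "\<dots> \<longleftrightarrow> summable (\<lambda>n. dirichlet_weight a n * (cmod (coef f n))\<^sup>2)"
    unfolding bergman_space_norm(1)[OF f' a] shift
    by (rule summable_Suc_iff[of "\<lambda>n. dirichlet_weight a n * (cmod (coef f n))\<^sup>2"])
  finally show ?A .
  assume mem: "f \<in> dirichlet_space a"
  then have mem': "deriv f \<in> bergman_space a" by (simp add: dirichlet_space_def)
  have "0 \<le> (\<Sum>n. bergman_weight a n * (cmod (coef (deriv f) n))\<^sup>2)"
    using mem' bergman_space_norm(1)[OF f' a] less_imp_le[OF bergman_weight_pos[OF a]]
    by (intro suminf_nonneg mult_nonneg_nonneg) auto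
  then have "(bergman_norm a (deriv f))\<^sup>2 = (\<Sum>n. dirichlet_weight a (Suc n) * (cmod (coef f (Suc n)))\<^sup>2)"
    unfolding bergman_space_norm(2)[OF f' a mem'] shift by simp
  also have "\<dots> = (\<Sum>n. dirichlet_weight a n * (cmod (coef f n))\<^sup>2) - (cmod (f 0))\<^sup>2"
    using suminf_split_head[of "\<lambda>n. dirichlet_weight a n * (cmod (coef f n))\<^sup>2"] \<open>?A\<close> mem
    by (simp add: dirichlet_weight_def coef_0)
  finally show ?B by (simp add: dirichlet_norm_def)
qed

text \<open>The bound 0 < a puts the exponent 1 - a below 1.\<close>

lemma dirichlet_hilbert_schmidt_iff:
  assumes "g holomorphic_on unit_disc" and a: "0 < a" "a \<le> 1"
  shows "hilbert_schmidt_on (dirichlet_space a) (dirichlet_norm a) (generalized_hilbert g) \<longleftrightarrow>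
    summable (\<lambda>m. (cmod (coef (deriv g) m))\<^sup>2 / (real m + 1))"
proof -
  obtain A B where AB: "0 < A" "\<And>n. A * (real n + 1) powr (1 - a) \<le> dirichlet_weight a n"
    "\<And>n. dirichlet_weight a n \<le> B * (real n + 1) powr (1 - a)"
    using dirichlet_weight_bounds[OF a] by auto
  have a': "-1 < a" using a by simp
  have hol: "f holomorphic_on unit_disc" if "f \<in> dirichlet_space a" for f
    using that by (simp add: dirichlet_space_def)
  interpret weighted_taylor_space "dirichlet_space a" "dirichlet_norm a" "dirichlet_weight a" "1 - a" A B
  proof
    fix f :: "complex \<Rightarrow> complex"
    show "f \<in> dirichlet_space a \<longleftrightarrow> f holomorphic_on unit_disc \<and> summable (\<lambda>n. dirichlet_weight a n * (cmod (coef f n))\<^sup>2)"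
      using dirichlet_space_norm(1)[OF _ a'] hol by blast
    show "dirichlet_norm a f = sqrt (\<Sum>n. dirichlet_weight a n * (cmod (coef f n))\<^sup>2)" if "f \<in> dirichlet_space a"
      by (rule dirichlet_space_norm(2)[OF hol[OF that] a' that])
  qed (use AB a in auto)
  show ?thesis by (rule hilbert_schmidt_iff[OF assms(1)])
qed

text \<open>The classical space has s = 1 and is no instance of the locale, but only membership of
  \<open>g\<close> matters: for \<alpha> = 0 the Bergman weight of \<open>deriv g\<close> is exactly
  1 / (n + 1).\<close>

lemma classical_dirichlet_space_iff:
  assumes "g holomorphic_on unit_disc"
  shows "g \<in> dirichlet_space 0 \<longleftrightarrow> summable (\<lambda>m. (cmod (coef (deriv g) m))\<^sup>2 / (real m + 1))"
proof -
  have "deriv g holomorphic_on unit_disc"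
    using assms by (intro holomorphic_deriv) auto
  moreover have "bergman_weight 0 n = 1 / (real n + 1)" for n
  proof -
    have "bergman_weight 0 n = fact n / pochhammer 1 (Suc n)"
      using Beta_eq_fact_pochhammer[of 0 n] by (simp add: bergman_weight_def)
    also have "\<dots> = 1 / (real n + 1)"
      unfolding pochhammer_fact[symmetric] fact_Suc by (simp add: add.commute del: of_nat_Suc)
    finally show ?thesis .
  qed
  ultimately show ?thesis
    using assms bergman_space_norm(1)[of "deriv g" 0] by (simp add: dirichlet_space_def)
qed

theorem theorem6:
  fixes g :: "complex \<Rightarrow> complex"
  assumes "g holomorphic_on unit_disc"
  shows "(hilbert_schmidt_on hardy_space hardy_norm (generalized_hilbert g)
            \<longleftrightarrow> (\<forall>\<alpha>. -1 < \<alpha> \<and> \<alpha> < 0 \<longrightarrow>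
                  hilbert_schmidt_on (bergman_space \<alpha>) (bergman_norm \<alpha>) (generalized_hilbert g)))
       \<and> ((\<forall>\<alpha>. -1 < \<alpha> \<and> \<alpha> < 0 \<longrightarrow>
              hilbert_schmidt_on (bergman_space \<alpha>) (bergman_norm \<alpha>) (generalized_hilbert g))
            \<longleftrightarrow> (\<forall>\<alpha>. 0 < \<alpha> \<and> \<alpha> \<le> 1 \<longrightarrow>
                  hilbert_schmidt_on (dirichlet_space \<alpha>) (dirichlet_norm \<alpha>) (generalized_hilbert g)))
       \<and> ((\<forall>\<alpha>. 0 < \<alpha> \<and> \<alpha> \<le> 1 \<longrightarrow>
              hilbert_schmidt_on (dirichlet_space \<alpha>) (dirichlet_norm \<alpha>) (generalized_hilbert g))
            \<longleftrightarrow> g \<in> dirichlet_space 0)"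
proof -
  let ?S = "summable (\<lambda>m. (cmod (coef (deriv g) m))\<^sup>2 / (real m + 1))"
  have "(\<forall>\<alpha>. -1 < \<alpha> \<and> \<alpha> < 0 \<longrightarrow>
      hilbert_schmidt_on (bergman_space \<alpha>) (bergman_norm \<alpha>) (generalized_hilbert g)) \<longleftrightarrow> ?S"
  proof
    assume "\<forall>\<alpha>. -1 < \<alpha> \<and> \<alpha> < 0 \<longrightarrow>
      hilbert_schmidt_on (bergman_space \<alpha>) (bergman_norm \<alpha>) (generalized_hilbert g)"
    \<comment> \<open>A single exponent suffices, because the criterion does not depend on it; -1/2
      is one in the range.\<close>
    from this[rule_format, of "-1/2"] show ?S
      by (simp add: bergman_hilbert_schmidt_iff[OF assms])
  qed (simp add: bergman_hilbert_schmidt_iff[OF assms])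
  moreover have "(\<forall>\<alpha>. 0 < \<alpha> \<and> \<alpha> \<le> 1 \<longrightarrow>
      hilbert_schmidt_on (dirichlet_space \<alpha>) (dirichlet_norm \<alpha>) (generalized_hilbert g)) \<longleftrightarrow> ?S"
  proof
    assume "\<forall>\<alpha>. 0 < \<alpha> \<and> \<alpha> \<le> 1 \<longrightarrow>
      hilbert_schmidt_on (dirichlet_space \<alpha>) (dirichlet_norm \<alpha>) (generalized_hilbert g)"
    \<comment> \<open>Likewise any exponent of the range (0, 1] would do.\<close>
    from this[rule_format, of 1] show ?S
      by (simp add: dirichlet_hilbert_schmidt_iff[OF assms])
  qed (simp add: dirichlet_hilbert_schmidt_iff[OF assms])
  ultimately show ?thesis
    by (simp add: hardy_hilbert_schmidt_iff[OF assms] classical_dirichlet_space_iff[OF assms])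
qed

end
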